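(* Let $\alpha>0$ and let $\Omega\subset\mathbb{R}^N$ be a bounded domain whose Poincaré constant $C_\Omega$ satisfies $$C_\Omega<\sqrt2.$$ There exist $\gamma_0>0$, $\gamma_1>0$ and a strictly decreasing function $\eta_0\in C_0(\mathbb{R}_+)$ such that for any initial condition $(z_0,z_1)\in H^1_0(\Omega)\times L^2(\Omega)$, the system $$\left\{\begin{aligned}&\partial_t^2 z(t,x)-\Delta z(t,x)=-\alpha\,\partial_t z(t_k,x), && (t,x)\in[t_k,t_{k+1}[\times\Omega,\ \forall k\in\mathbb{N},\\ &z(t,x)=0, && (t,x)\in\mathbb{R}_+\times\partial\Omega,\\ &z(0,x)=z_0(x),\quad \partial_t z(0,x)=z_1(x), && x\in\Omega,\end{aligned}\right.$$ under the event-triggering mechanism $t_0=0$, $$t_{k+1}:=\inf\Big\{t\ge t_k:\ \|e_k(t)\|_{L^2(\Omega)}^2-\gamma_0\|z(t)\|_{L^2(\Omega)}^2-\gamma_1\|\partial_t z(t)\|_{L^2(\Omega)}^2-\eta_0(t)\ge 0\Big\},$$ with $e_k(t,\cdot):=\partial_t z(t,\cdot)-\partial_t z(t_k,\cdot)$ in $\Omega$, is exponentially stable: there exist $K,\delta>0$ such that $$E(t)\le K e^{-\delta t}E(0),\qquad\forall t>0,$$ where $E(t):=\frac12\big(\|\partial_t z(t)\|_{L^2(\Omega)}^2+\|\nabla z(t)\|_{L^2(\Omega)}^2\big)$.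
   Context: $C_\Omega$ denotes the Poincaré constant of $\Omega$, i.e. the optimal constant such that $\|u\|_{L^2(\Omega)}\le C_\Omega\|\nabla u\|_{L^2(\Omega)}$ for all $u\in H^1_0(\Omega)$. $C_0(\mathbb{R}_+)$ is the space of continuous functions on $\mathbb{R}_+$ vanishing at infinity. The sampling times $(t_k)_{k\in\mathbb{N}}$ are generated along the solution by the event-triggering rule; if the set in the definition of $t_{k+1}$ is empty then $t_{k+1}=+\infty$ and no further sampling occurs. The function $\eta_0$ in the event-triggering mechanism is decreasing and strictly positive. The solution is the function $z\in C^0(\mathbb{R}_+;H^1_0(\Omega))\cap C^1(\mathbb{R}_+;L^2(\Omega))$ which on each interval $[t_k,t_{k+1}[$ solves, in the usual weak/semigroup sense, the linear wave equation with homogeneous Dirichlet boundary condition and time-independent source $-\alpha\partial_t z(t_k,\cdot)$. *)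

theory Defs
  imports "HOL-Analysis.Analysis"
begin

text \<open>
  Elements of \<open>L\<^sup>2(\<Omega>)\<close> are represented by functions on the whole ambient Euclidean space, of which
  only the values on \<open>\<Omega>\<close> matter, and only up to null sets.
\<close>

definition L2_space :: "'a::euclidean_space set \<Rightarrow> ('a \<Rightarrow> 'b::euclidean_space) set" where
  "L2_space \<Omega> = {f \<in> borel_measurable (lebesgue_on \<Omega>).
                    integrable (lebesgue_on \<Omega>) (\<lambda>x. (norm (f x))\<^sup>2)}"

definition L2_inner ::
    "'a::euclidean_space set \<Rightarrow> ('a \<Rightarrow> 'b::euclidean_space) \<Rightarrow> ('a \<Rightarrow> 'b) \<Rightarrow> real" where
  "L2_inner \<Omega> f g = (LINT x|lebesgue_on \<Omega>. f x \<bullet> g x)"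

definition L2_norm :: "'a::euclidean_space set \<Rightarrow> ('a \<Rightarrow> 'b::euclidean_space) \<Rightarrow> real" where
  "L2_norm \<Omega> f = sqrt (LINT x|lebesgue_on \<Omega>. (norm (f x))\<^sup>2)"

definition partial_deriv :: "'a::euclidean_space \<Rightarrow> ('a \<Rightarrow> real) \<Rightarrow> 'a \<Rightarrow> real" where
  "partial_deriv b f x = frechet_derivative f (at x) b"

primrec C_k :: "nat \<Rightarrow> ('a::euclidean_space \<Rightarrow> real) \<Rightarrow> bool" where
  "C_k 0 f \<longleftrightarrow> continuous_on UNIV f"
| "C_k (Suc n) f \<longleftrightarrow> (\<forall>x. f differentiable at x) \<and> (\<forall>b\<in>Basis. C_k n (partial_deriv b f))"

definition test_functions :: "'a::euclidean_space set \<Rightarrow> ('a \<Rightarrow> real) set" where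
  "test_functions \<Omega> = {\<phi>. (\<forall>n. C_k n \<phi>) \<and> compact (closure {x. \<phi> x \<noteq> 0})
                            \<and> closure {x. \<phi> x \<noteq> 0} \<subseteq> \<Omega>}"

definition has_weak_gradient ::
    "'a::euclidean_space set \<Rightarrow> ('a \<Rightarrow> real) \<Rightarrow> ('a \<Rightarrow> 'a) \<Rightarrow> bool" where
  "has_weak_gradient \<Omega> u g \<longleftrightarrow>
     (\<forall>\<phi>\<in>test_functions \<Omega>. \<forall>b\<in>Basis.
        (LINT x|lebesgue_on \<Omega>. u x * partial_deriv b \<phi> x)
          = - (LINT x|lebesgue_on \<Omega>. (g x \<bullet> b) * \<phi> x))"

definition H1_space :: "'a::euclidean_space set \<Rightarrow> ('a \<Rightarrow> real) set" where
  "H1_space \<Omega> = {u \<in> L2_space \<Omega>. \<exists>g\<in>L2_space \<Omega>. has_weak_gradient \<Omega> u g}"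

text \<open>
  The weak gradient is unique almost everywhere on \<open>\<Omega>\<close>; an arbitrary representative is chosen.
  It is meaningful only for elements of \<^const>\<open>H1_space\<close>.
\<close>

definition weak_gradient :: "'a::euclidean_space set \<Rightarrow> ('a \<Rightarrow> real) \<Rightarrow> 'a \<Rightarrow> 'a" where
  "weak_gradient \<Omega> u = (SOME g. g \<in> L2_space \<Omega> \<and> has_weak_gradient \<Omega> u g)"

definition H1_norm :: "'a::euclidean_space set \<Rightarrow> ('a \<Rightarrow> real) \<Rightarrow> real" where
  "H1_norm \<Omega> u = sqrt ((L2_norm \<Omega> u)\<^sup>2 + (L2_norm \<Omega> (weak_gradient \<Omega> u))\<^sup>2)"

definition H10_space :: "'a::euclidean_space set \<Rightarrow> ('a \<Rightarrow> real) set" where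
  "H10_space \<Omega> = {u \<in> H1_space \<Omega>.
     \<forall>\<epsilon>>0. \<exists>\<phi>\<in>test_functions \<Omega>. H1_norm \<Omega> (\<lambda>x. u x - \<phi> x) < \<epsilon>}"

text \<open>
  The value is extended real, so that it would be \<open>\<infinity>\<close> if no constant were admissible; for
  bounded \<open>\<Omega>\<close> it is finite and attained.
\<close>

definition poincare_constant :: "'a::euclidean_space set \<Rightarrow> ereal" where
  "poincare_constant \<Omega> =
     (INF C \<in> {C::real. 0 \<le> C \<and>
        (\<forall>u\<in>H10_space \<Omega>. L2_norm \<Omega> u \<le> C * L2_norm \<Omega> (weak_gradient \<Omega> u))}. ereal C)"

definition C0_halfline :: "(real \<Rightarrow> real) set" where
  "C0_halfline = {f. continuous_on {0..} f \<and> (f \<longlongrightarrow> 0) at_top}"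

text \<open>
  Continuity and differentiability of curves on \<open>[0,\<infinity>)\<close> are taken with respect to the given norm
  (one-sided at \<open>0\<close>), not pointwise in space.
\<close>

definition curve_continuous ::
    "(('a \<Rightarrow> real) \<Rightarrow> real) \<Rightarrow> (real \<Rightarrow> 'a \<Rightarrow> real) \<Rightarrow> bool" where
  "curve_continuous N u \<longleftrightarrow>
     (\<forall>t\<ge>0. ((\<lambda>s. N (\<lambda>x. u s x - u t x)) \<longlongrightarrow> 0) (at t within {0..}))"

definition curve_has_derivative ::
    "(('a \<Rightarrow> real) \<Rightarrow> real) \<Rightarrow> (real \<Rightarrow> 'a \<Rightarrow> real) \<Rightarrow> (real \<Rightarrow> 'a \<Rightarrow> real) \<Rightarrow> bool" where
  "curve_has_derivative N u u' \<longleftrightarrow>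
     (\<forall>t\<ge>0. ((\<lambda>s. N (\<lambda>x. (u s x - u t x) / (s - t) - u' t x)) \<longlongrightarrow> 0) (at t within {0..}))"

text \<open>\<open>C\<^sup>0(\<real>\<^sub>+; H\<^sup>1\<^sub>0(\<Omega>)) \<inter> C\<^sup>1(\<real>\<^sub>+; L\<^sup>2(\<Omega>))\<close>, with \<open>z'\<close> the time derivative of \<open>z\<close>.\<close>

definition finite_energy_curve ::
    "'a::euclidean_space set \<Rightarrow> (real \<Rightarrow> 'a \<Rightarrow> real) \<Rightarrow> (real \<Rightarrow> 'a \<Rightarrow> real) \<Rightarrow> bool" where
  "finite_energy_curve \<Omega> z z' \<longleftrightarrow>
     (\<forall>t\<ge>0. z t \<in> H10_space \<Omega>) \<and> curve_continuous (H1_norm \<Omega>) z \<and>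
     (\<forall>t\<ge>0. z' t \<in> L2_space \<Omega>) \<and> curve_has_derivative (L2_norm \<Omega>) z z' \<and>
     curve_continuous (L2_norm \<Omega>) z'"

text \<open>
  Weak form of \<open>\<partial>\<^sub>t\<^sup>2 z - \<Delta> z = f\<close> with homogeneous Dirichlet condition on the time interval \<open>I\<close>,
  for a source \<open>f \<in> L\<^sup>2(\<Omega>)\<close> that does not depend on time; the boundary condition is carried by
  \<open>z t \<in> H\<^sup>1\<^sub>0(\<Omega>)\<close>.
\<close>

definition weak_wave_solution_on ::
    "'a::euclidean_space set \<Rightarrow> real set \<Rightarrow> ('a \<Rightarrow> real) \<Rightarrow>
     (real \<Rightarrow> 'a \<Rightarrow> real) \<Rightarrow> (real \<Rightarrow> 'a \<Rightarrow> real) \<Rightarrow> bool" where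
  "weak_wave_solution_on \<Omega> I f z z' \<longleftrightarrow>
     (\<forall>v\<in>H10_space \<Omega>. \<forall>t\<in>I.
        ((\<lambda>s. L2_inner \<Omega> (z' s) v) has_real_derivative
           L2_inner \<Omega> f v - L2_inner \<Omega> (weak_gradient \<Omega> (z t)) (weak_gradient \<Omega> v))
        (at t within I))"

text \<open>
  Sampling times are extended reals. Since \<open>Inf {} = \<infinity>\<close>, an empty triggering set gives the next
  time \<open>\<infinity>\<close>, and all later times are \<open>\<infinity>\<close> as well; the value \<open>real_of_ereal \<infinity>\<close> never
  matters, because no real \<open>s\<close> satisfies \<open>\<infinity> \<le> ereal s\<close>.
\<close>

definition event_times ::
    "'a::euclidean_space set \<Rightarrow> real \<Rightarrow> real \<Rightarrow> (real \<Rightarrow> real) \<Rightarrow>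
     (real \<Rightarrow> 'a \<Rightarrow> real) \<Rightarrow> (real \<Rightarrow> 'a \<Rightarrow> real) \<Rightarrow> (nat \<Rightarrow> ereal) \<Rightarrow> bool" where
  "event_times \<Omega> \<gamma>\<^sub>0 \<gamma>\<^sub>1 \<eta>\<^sub>0 z z' \<tau> \<longleftrightarrow>
     \<tau> 0 = 0 \<and>
     (\<forall>k. \<tau> (Suc k) = Inf {ereal s | s. \<tau> k \<le> ereal s \<and>
        (L2_norm \<Omega> (\<lambda>x. z' s x - z' (real_of_ereal (\<tau> k)) x))\<^sup>2
          - \<gamma>\<^sub>0 * (L2_norm \<Omega> (z s))\<^sup>2 - \<gamma>\<^sub>1 * (L2_norm \<Omega> (z' s))\<^sup>2 - \<eta>\<^sub>0 s \<ge> 0})"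

definition event_triggered_solution ::
    "'a::euclidean_space set \<Rightarrow> real \<Rightarrow> real \<Rightarrow> real \<Rightarrow> (real \<Rightarrow> real) \<Rightarrow>
     ('a \<Rightarrow> real) \<Rightarrow> ('a \<Rightarrow> real) \<Rightarrow>
     (real \<Rightarrow> 'a \<Rightarrow> real) \<Rightarrow> (real \<Rightarrow> 'a \<Rightarrow> real) \<Rightarrow> (nat \<Rightarrow> ereal) \<Rightarrow> bool" where
  "event_triggered_solution \<Omega> \<alpha> \<gamma>\<^sub>0 \<gamma>\<^sub>1 \<eta>\<^sub>0 z\<^sub>0 z\<^sub>1 z z' \<tau> \<longleftrightarrow>
     finite_energy_curve \<Omega> z z' \<and>
     (AE x in lebesgue_on \<Omega>. z 0 x = z\<^sub>0 x) \<and> (AE x in lebesgue_on \<Omega>. z' 0 x = z\<^sub>1 x) \<and>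
     event_times \<Omega> \<gamma>\<^sub>0 \<gamma>\<^sub>1 \<eta>\<^sub>0 z z' \<tau> \<and>
     (\<forall>k. weak_wave_solution_on \<Omega> {s. \<tau> k \<le> ereal s \<and> ereal s < \<tau> (Suc k)}
            (\<lambda>x. - \<alpha> * z' (real_of_ereal (\<tau> k)) x) z z')"

definition energy ::
    "'a::euclidean_space set \<Rightarrow> (real \<Rightarrow> 'a \<Rightarrow> real) \<Rightarrow> (real \<Rightarrow> 'a \<Rightarrow> real) \<Rightarrow> real \<Rightarrow> real" where
  "energy \<Omega> z z' t =
     1 / 2 * ((L2_norm \<Omega> (z' t))\<^sup>2 + (L2_norm \<Omega> (weak_gradient \<Omega> (z t)))\<^sup>2)"

end

theory Submission
  imports Defs
begin

text \<open>
  The closed loop is the damped wave equation \<open>\<partial>\<^sub>t\<^sup>2 z - \<Delta>z = - \<alpha> \<partial>\<^sub>t z + \<alpha> e\<close>, perturbed by the sampling error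
  \<open>e = \<partial>\<^sub>t z - \<partial>\<^sub>t z(t\<^sub>k)\<close>, and the triggering rule keeps \<open>\<parallel>e\<parallel>\<^sup>2\<close> below
  \<open>\<gamma>\<^sub>0 \<parallel>z\<parallel>\<^sup>2 + \<gamma>\<^sub>1 \<parallel>\<partial>\<^sub>t z\<parallel>\<^sup>2 + \<eta>\<^sub>0(t)\<close>. The functional
  \<open>V = E + \<epsilon> (\<langle>\<partial>\<^sub>t z, z\<rangle> + \<alpha>/2 \<parallel>z\<parallel>\<^sup>2)\<close> is equivalent to the energy for small \<open>\<epsilon>\<close>, and for
  small \<open>\<gamma>\<^sub>0, \<gamma>\<^sub>1\<close> the first two terms of the bound are absorbed by the damping, so that
  \<open>V' \<le> - (\<epsilon>/2) V + \<alpha> \<eta>\<^sub>0\<close> (lemmas \<open>damping_dominates\<close> and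
  \<open>weighted_lyapunov_decreases_between_samples\<close>). With \<open>\<eta>\<^sub>0(t) = exp (- t)\<close> the inhomogeneity decays faster
  than \<open>V\<close>, whence \<open>V(t) \<le> exp (- \<epsilon> t/2) (V(0) + c)\<close>. The constant \<open>c\<close> is independent of the initial
  data, so dividing by \<open>E(0)\<close> makes \<open>K\<close> depend on the solution. This fails for \<open>E(0) = 0\<close>, where instead
  the solution is at rest and no further sampling is triggered (\<open>event_triggered_solution_zero\<close>).

  Three points need care for solutions of finite energy only. First, \<open>\<partial>\<^sub>t z\<close> is merely in \<open>L\<^sup>2\<close>, so it is
  not an admissible test function and the energy identity cannot be read off the weak formulation.
  Since the source \<open>f\<close> is constant in time, one may test with time translates of \<open>z\<close> itself:
  \<open>d/dt (\<langle>z'(t), z(t+h)\<rangle> - \<langle>z'(t+h), z(t)\<rangle>) = \<langle>f, z(t+h) - z(t)\<rangle>\<close>, because the Dirichlet form is symmetric;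
  division by \<open>h\<close> and \<open>h \<rightarrow> 0+\<close> give \<open>E(t) - E(s) = \<langle>f, z(t) - z(s)\<rangle>\<close> (\<open>energy_identity\<close>).

  Second, the estimates on successive sampling intervals are glued by continuity of \<open>E\<close>. Convergence
  in \<open>H\<^sup>1\<close> controls the weak gradient of a difference, and this is the difference of the
  chosen weak gradients only because weak gradients are unique almost everywhere; uniqueness is the
  fundamental lemma of the calculus of variations, proved with explicit bump functions on boxes.

  Third, the sampling times must exhaust the half line (\<open>sampling_times_unbounded\<close>): at a
  sampling time the velocity has moved by at least \<open>\<eta>\<^sub>0\<close> (in squared norm) since the previous one, which
  contradicts the continuity of \<open>\<partial>\<^sub>t z\<close> at a finite accumulation point.
\<close>

section \<open>The inner product of square integrable functions\<close>

lemma L2_space_integrable_inner: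
  assumes "f \<in> L2_space \<Omega>" "g \<in> L2_space \<Omega>"
  shows "integrable (lebesgue_on \<Omega>) (\<lambda>x. f x \<bullet> g x)"
proof (rule Bochner_Integration.integrable_bound)
  show "integrable (lebesgue_on \<Omega>) (\<lambda>x. (norm (f x))\<^sup>2 + (norm (g x))\<^sup>2)"
    using assms by (auto simp: L2_space_def)
  show "(\<lambda>x. f x \<bullet> g x) \<in> borel_measurable (lebesgue_on \<Omega>)"
    using assms by (auto simp: L2_space_def intro: borel_measurable_inner)
  have "norm (f x \<bullet> g x) \<le> norm ((norm (f x))\<^sup>2 + (norm (g x))\<^sup>2)" for x
    using Cauchy_Schwarz_ineq2[of "f x" "g x"] sum_squares_bound[of "norm (f x)" "norm (g x)"]
      mult_nonneg_nonneg[of "norm (f x)" "norm (g x)"]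
    by simp
  then show "AE x in lebesgue_on \<Omega>. norm (f x \<bullet> g x) \<le> norm ((norm (f x))\<^sup>2 + (norm (g x))\<^sup>2)"
    by simp
qed

lemma L2_space_add:
  assumes "f \<in> L2_space \<Omega>" "g \<in> L2_space \<Omega>"
  shows "(\<lambda>x. f x + g x) \<in> L2_space \<Omega>"
proof -
  have "integrable (lebesgue_on \<Omega>) (\<lambda>x. (norm (f x))\<^sup>2 + (norm (g x))\<^sup>2 + 2 * (f x \<bullet> g x))"
    using assms L2_space_integrable_inner[OF assms] by (auto simp: L2_space_def)
  moreover have "(\<lambda>x. (norm (f x))\<^sup>2 + (norm (g x))\<^sup>2 + 2 * (f x \<bullet> g x)) = (\<lambda>x. (norm (f x + g x))\<^sup>2)"
    by (simp add: power2_norm_eq_inner inner_add_left inner_add_right inner_commute fun_eq_iff)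
  ultimately show ?thesis
    using assms by (auto simp: L2_space_def)
qed

lemma L2_space_scaleR:
  assumes "f \<in> L2_space \<Omega>"
  shows "(\<lambda>x. c *\<^sub>R f x) \<in> L2_space \<Omega>"
  using assms by (auto simp: L2_space_def power_mult_distrib)

lemma L2_space_cmult:
  assumes "f \<in> L2_space \<Omega>"
  shows "(\<lambda>x. c * f x :: real) \<in> L2_space \<Omega>"
  using L2_space_scaleR[OF assms, of c] by simp

lemma L2_space_divide:
  assumes "f \<in> L2_space \<Omega>"
  shows "(\<lambda>x. f x / c :: real) \<in> L2_space \<Omega>"
  using L2_space_cmult[OF assms, of "1 / c"] by simp

lemma L2_space_diff:
  assumes "f \<in> L2_space \<Omega>" "g \<in> L2_space \<Omega>"
  shows "(\<lambda>x. f x - g x) \<in> L2_space \<Omega>"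
  using L2_space_add[OF assms(1) L2_space_scaleR[OF assms(2), of "-1"]] by simp

lemma L2_inner_commute: "L2_inner \<Omega> f g = L2_inner \<Omega> g f"
  by (simp add: L2_inner_def inner_commute)

lemma L2_inner_add_left:
  assumes "f \<in> L2_space \<Omega>" "g \<in> L2_space \<Omega>" "h \<in> L2_space \<Omega>"
  shows "L2_inner \<Omega> (\<lambda>x. f x + g x) h = L2_inner \<Omega> f h + L2_inner \<Omega> g h"
  using assms by (simp add: L2_inner_def inner_add_left L2_space_integrable_inner)

lemma L2_inner_diff_left:
  assumes "f \<in> L2_space \<Omega>" "g \<in> L2_space \<Omega>" "h \<in> L2_space \<Omega>"
  shows "L2_inner \<Omega> (\<lambda>x. f x - g x) h = L2_inner \<Omega> f h - L2_inner \<Omega> g h"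
  using assms by (simp add: L2_inner_def inner_diff_left L2_space_integrable_inner)

lemma L2_inner_diff_right:
  assumes "f \<in> L2_space \<Omega>" "g \<in> L2_space \<Omega>" "h \<in> L2_space \<Omega>"
  shows "L2_inner \<Omega> h (\<lambda>x. f x - g x) = L2_inner \<Omega> h f - L2_inner \<Omega> h g"
  using assms by (simp add: L2_inner_def inner_diff_right L2_space_integrable_inner)

lemma L2_inner_scaleR_left: "L2_inner \<Omega> (\<lambda>x. c *\<^sub>R f x) g = c * L2_inner \<Omega> f g"
  by (simp add: L2_inner_def)

lemma L2_inner_cmult_left: "L2_inner \<Omega> (\<lambda>x. c * f x :: real) g = c * L2_inner \<Omega> f g"
  using L2_inner_scaleR_left[of \<Omega> c f g] by simp

lemma L2_inner_divide_right: "L2_inner \<Omega> g (\<lambda>x. f x / c :: real) = L2_inner \<Omega> g f / c"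
  using L2_inner_cmult_left[of \<Omega> "1/c" f g] by (simp add: L2_inner_commute)

lemma L2_norm_nonneg [simp]: "0 \<le> L2_norm \<Omega> f"
  by (simp add: L2_norm_def)

lemma L2_norm_power2: "(L2_norm \<Omega> f)\<^sup>2 = L2_inner \<Omega> f f"
  by (simp add: L2_norm_def L2_inner_def power2_norm_eq_inner)

lemma L2_norm_minus_commute: "L2_norm \<Omega> (\<lambda>x. f x - g x) = L2_norm \<Omega> (\<lambda>x. g x - f x)"
  by (simp add: L2_norm_def norm_minus_commute)

text \<open>As a polynomial in \<open>r\<close> the right-hand side is nonnegative; Cauchy--Schwarz is the nonpositivity
  of its discriminant.\<close>

lemma L2_norm_add_scaleR_power2:
  assumes "f \<in> L2_space \<Omega>" "g \<in> L2_space \<Omega>"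
  shows "(L2_norm \<Omega> (\<lambda>x. f x + r *\<^sub>R g x))\<^sup>2
           = (L2_norm \<Omega> f)\<^sup>2 + 2 * r * L2_inner \<Omega> f g + r\<^sup>2 * (L2_norm \<Omega> g)\<^sup>2"
proof -
  note mem = assms L2_space_scaleR[OF assms(2), of r] L2_space_add[OF assms(1) L2_space_scaleR[OF assms(2), of r]]
  have "L2_inner \<Omega> (\<lambda>x. f x + r *\<^sub>R g x) k = L2_inner \<Omega> f k + r * L2_inner \<Omega> g k"
    if "k \<in> L2_space \<Omega>" for k
    using L2_inner_add_left[OF mem(1,3) that] L2_inner_scaleR_left[of \<Omega> r g k] by simp
  then show ?thesis
    unfolding L2_norm_power2 using mem
    by (simp add: L2_inner_commute[of \<Omega> f "\<lambda>x. f x + r *\<^sub>R g x"] L2_inner_commute[of \<Omega> g "\<lambda>x. f x + r *\<^sub>R g x"]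
        L2_inner_commute[of \<Omega> g f] power2_eq_square algebra_simps)
qed

lemma L2_inner_Cauchy_Schwarz:
  assumes "f \<in> L2_space \<Omega>" "g \<in> L2_space \<Omega>"
  shows "\<bar>L2_inner \<Omega> f g\<bar> \<le> L2_norm \<Omega> f * L2_norm \<Omega> g"
proof -
  define a b c where "a = (L2_norm \<Omega> f)\<^sup>2" and "b = L2_inner \<Omega> f g" and "c = (L2_norm \<Omega> g)\<^sup>2"
  have q: "0 \<le> a + 2 * r * b + r\<^sup>2 * c" for r
    using L2_norm_add_scaleR_power2[OF assms, of r]
    unfolding a_def b_def c_def by (metis zero_le_power2)
  have "b\<^sup>2 \<le> a * c"
  proof (cases "c = 0")
    case True
    have "b = 0"
    proof (rule ccontr)
      assume "b \<noteq> 0"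
      \<comment> \<open>the polynomial is affine in \<open>r\<close>, and takes the value \<open>- 1\<close> at this point\<close>
      then show False
        using q[of "- (a + 1) / (2 * b)"] True by (simp add: field_simps)
    qed
    then show ?thesis using True by simp
  next
    case False
    then have "c > 0" by (simp add: c_def)
    then show ?thesis
      using q[of "- b / c"] by (simp add: field_simps power2_eq_square)
  qed
  then have "\<bar>b\<bar>\<^sup>2 \<le> (L2_norm \<Omega> f * L2_norm \<Omega> g)\<^sup>2"
    by (simp add: a_def c_def power_mult_distrib)
  then show ?thesis
    unfolding b_def by (rule power2_le_imp_le) simp
qed

lemma L2_norm_triangle:
  assumes "f \<in> L2_space \<Omega>" "g \<in> L2_space \<Omega>"
  shows "L2_norm \<Omega> (\<lambda>x. f x + g x) \<le> L2_norm \<Omega> f + L2_norm \<Omega> g"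
proof (rule power2_le_imp_le)
  show "(L2_norm \<Omega> (\<lambda>x. f x + g x))\<^sup>2 \<le> (L2_norm \<Omega> f + L2_norm \<Omega> g)\<^sup>2"
    using L2_norm_add_scaleR_power2[OF assms, of 1] L2_inner_Cauchy_Schwarz[OF assms]
    by (simp add: power2_sum)
qed simp

lemma L2_norm_triangle_diff:
  assumes "f \<in> L2_space \<Omega>" "g \<in> L2_space \<Omega>" "h \<in> L2_space \<Omega>"
  shows "L2_norm \<Omega> (\<lambda>x. f x - h x) \<le> L2_norm \<Omega> (\<lambda>x. f x - g x) + L2_norm \<Omega> (\<lambda>x. g x - h x)"
  using L2_norm_triangle[OF L2_space_diff[OF assms(1,2)] L2_space_diff[OF assms(2,3)]] by simp

lemma L2_norm_diff_ineq:
  assumes "f \<in> L2_space \<Omega>" "g \<in> L2_space \<Omega>"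
  shows "\<bar>L2_norm \<Omega> f - L2_norm \<Omega> g\<bar> \<le> L2_norm \<Omega> (\<lambda>x. f x - g x)"
  using L2_norm_triangle[OF assms(2) L2_space_diff[OF assms]]
    L2_norm_triangle[OF assms(1) L2_space_diff[OF assms(2,1)]]
    L2_norm_minus_commute[of \<Omega> f g]
  by simp

text \<open>Continuity of the inner product along norm-convergent curves. Membership is required on \<open>S\<close> only,
  because the curves below are meaningful for nonnegative times.\<close>

lemma tendsto_L2_inner:
  assumes "\<And>s. s \<in> S \<Longrightarrow> f s \<in> L2_space \<Omega>" "f' \<in> L2_space \<Omega>"
    and "\<And>s. s \<in> S \<Longrightarrow> g s \<in> L2_space \<Omega>" "g' \<in> L2_space \<Omega>"
    and lf: "((\<lambda>s. L2_norm \<Omega> (\<lambda>x. f s x - f' x)) \<longlongrightarrow> 0) (at t within S)"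
    and lg: "((\<lambda>s. L2_norm \<Omega> (\<lambda>x. g s x - g' x)) \<longlongrightarrow> 0) (at t within S)"
  shows "((\<lambda>s. L2_inner \<Omega> (f s) (g s)) \<longlongrightarrow> L2_inner \<Omega> f' g') (at t within S)"
proof (rule Lim_null[THEN iffD2], rule Lim_null_comparison)
  define F where "F s = L2_norm \<Omega> (\<lambda>x. f s x - f' x)" for s
  define G where "G s = L2_norm \<Omega> (\<lambda>x. g s x - g' x)" for s
  have "norm (L2_inner \<Omega> (f s) (g s) - L2_inner \<Omega> f' g')
          \<le> F s * G s + F s * L2_norm \<Omega> g' + L2_norm \<Omega> f' * G s" if "s \<in> S" for s
  proof -
    note m = assms(1)[OF that] assms(2) assms(3)[OF that] assms(4)
    note d = L2_space_diff[OF m(1,2)] L2_space_diff[OF m(3,4)]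
    have "L2_inner \<Omega> (f s) (g s) - L2_inner \<Omega> f' g'
            = L2_inner \<Omega> (\<lambda>x. f s x - f' x) (\<lambda>x. g s x - g' x)
              + L2_inner \<Omega> (\<lambda>x. f s x - f' x) g' + L2_inner \<Omega> f' (\<lambda>x. g s x - g' x)"
      using m d by (simp add: L2_inner_diff_left L2_inner_diff_right)
    then show ?thesis
      using L2_inner_Cauchy_Schwarz[OF d] L2_inner_Cauchy_Schwarz[OF d(1) m(4)]
        L2_inner_Cauchy_Schwarz[OF m(2) d(2)]
      unfolding F_def G_def by simp
  qed
  then show "\<forall>\<^sub>F s in at t within S. norm (L2_inner \<Omega> (f s) (g s) - L2_inner \<Omega> f' g')
      \<le> F s * G s + F s * L2_norm \<Omega> g' + L2_norm \<Omega> f' * G s"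
    by (simp add: eventually_at_filter)
  have "((\<lambda>s. F s * G s + F s * L2_norm \<Omega> g' + L2_norm \<Omega> f' * G s)
      \<longlongrightarrow> 0 * 0 + 0 * L2_norm \<Omega> g' + L2_norm \<Omega> f' * 0) (at t within S)"
    unfolding F_def G_def by (intro tendsto_intros lf lg)
  then show "((\<lambda>s. F s * G s + F s * L2_norm \<Omega> g' + L2_norm \<Omega> f' * G s) \<longlongrightarrow> 0) (at t within S)"
    by simp
qed

section \<open>Smooth functions with support in a box\<close>

text \<open>
  For \<open>j = 0\<close> this is the classical smooth function that is flat at the origin. The powers of
  \<open>x\<close> in the denominator make the family closed under differentiation up to linear combinations.
\<close>

definition flat :: "nat \<Rightarrow> real \<Rightarrow> real" where
  "flat j x = (if x > 0 then exp (- 1 / x) / x ^ j else 0)"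

text \<open>With \<open>y = 1 / x\<close> this is the decay of \<open>y\<^sup>j / exp y\<close> at infinity.\<close>

lemma flat_tendsto_0: "(flat j \<longlongrightarrow> 0) (at 0)"
proof -
  have "((\<lambda>x. (inverse x) ^ j / exp (inverse x)) \<longlongrightarrow> 0) (at_right (0::real))"
    by (rule filterlim_compose[OF tendsto_power_div_exp_0 filterlim_inverse_at_top_right])
  then have "(flat j \<longlongrightarrow> 0) (at_right 0)"
    by (rule Lim_transform_eventually)
      (auto simp: eventually_at_filter flat_def exp_minus field_simps)
  moreover have "(flat j \<longlongrightarrow> 0) (at_left 0)"
    by (rule tendsto_eventually) (auto simp: eventually_at_filter flat_def)
  ultimately show ?thesis
    by (simp add: filterlim_split_at)
qed

lemma flat_has_real_derivative:
  "(flat j has_real_derivative (flat (j + 2) x - real j * flat (j + 1) x)) (at x)"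
proof -
  consider "x < 0" | "x = 0" | "x > 0" by linarith
  then show ?thesis
  proof cases
    case 1
    then have "\<forall>\<^sub>F y in nhds x. y < 0"
      by (intro eventually_nhds_in_open[of "{..<0}", simplified]) auto
    then have "\<forall>\<^sub>F y in nhds x. flat j y = 0"
      by (rule eventually_mono) (auto simp: flat_def)
    then have "(flat j has_real_derivative 0) (at x) \<longleftrightarrow> ((\<lambda>_. 0) has_real_derivative 0) (at x)"
      by (intro DERIV_cong_ev) auto
    then show ?thesis using 1 by (simp add: flat_def)
  next
    case 2
    \<comment> \<open>the difference quotient at the origin is again a member of the family\<close>
    have "flat (Suc j) = (\<lambda>h. flat j h / h)"
      by (simp add: flat_def fun_eq_iff)
    then have "((\<lambda>h. (flat j (0 + h) - flat j 0) / h) \<longlongrightarrow> 0) (at 0)"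
      using flat_tendsto_0[of "Suc j"] by (simp add: flat_def[of j 0])
    then show ?thesis using 2 by (simp add: DERIV_def flat_def)
  next
    case 3
    then have "\<forall>\<^sub>F y in nhds x. y > 0"
      by (intro eventually_nhds_in_open[of "{0<..}", simplified]) auto
    then have ev: "\<forall>\<^sub>F y in nhds x. flat j y = exp (- 1 / y) / y ^ j"
      by (rule eventually_mono) (auto simp: flat_def)
    have "((\<lambda>y. exp (- 1 / y) / y ^ j) has_real_derivative
             (flat (j + 2) x - real j * flat (j + 1) x)) (at x)"
    proof (cases j)
      case 0
      then show ?thesis using 3
        by (auto intro!: derivative_eq_intros simp: flat_def field_simps power2_eq_square)
    next
      case (Suc i)
      have "x * x ^ (i - Suc 0) = x ^ i" if "i \<noteq> 0"
        using that by (cases i) auto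
      then show ?thesis using 3 Suc
        by (cases "i = 0") (auto intro!: derivative_eq_intros simp: flat_def field_simps power2_eq_square)
    qed
    then show ?thesis
      using DERIV_cong_ev[OF refl ev refl] by blast
  qed
qed

lemma flat_nonneg: "0 \<le> flat j x"
  by (simp add: flat_def)

lemma flat_0_le_1: "flat 0 x \<le> 1"
  by (simp add: flat_def)

lemma flat_eq_0_iff: "flat j x = 0 \<longleftrightarrow> x \<le> 0"
  by (auto simp: flat_def)

text \<open>Steepening \<open>flat 0\<close> approximates the Heaviside function from below without moving its support.\<close>

lemma flat_0_scaled_tendsto: "(\<lambda>m. flat 0 (real (Suc m) * y)) \<longlonglongrightarrow> (if y > 0 then 1 else 0)"
proof (cases "y > 0")
  case True
  have "(\<lambda>m. exp (- (1 / y) * inverse (real (Suc m)))) \<longlonglongrightarrow> exp (- (1 / y) * 0)"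
    by (intro tendsto_intros LIMSEQ_inverse_real_of_nat)
  moreover have "flat 0 (real (Suc m) * y) = exp (- (1 / y) * inverse (real (Suc m)))" for m
  proof -
    have "real (Suc m) * y > 0" using True by simp
    then show ?thesis by (simp add: flat_def divide_inverse mult.commute del: of_nat_Suc)
  qed
  ultimately show ?thesis using True by simp
next
  case False
  then have "flat 0 (real (Suc m) * y) = 0" for m
    by (simp add: flat_eq_0_iff mult_nonneg_nonpos)
  then show ?thesis using False by simp
qed

lemma C_k_differentiable: "C_k (Suc n) f \<Longrightarrow> f differentiable at x"
  by simp

lemma C_k_Suc_imp_C_k: "C_k (Suc n) f \<Longrightarrow> C_k n f"
proof (induction n arbitrary: f)
  case 0
  then show ?case
    by (auto simp: continuous_on_eq_continuous_at intro: differentiable_imp_continuous_within)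
qed auto

lemma C_k_const: "C_k n (\<lambda>x::'a::euclidean_space. c)"
proof (induction n arbitrary: c)
  case (Suc n)
  have "partial_deriv b (\<lambda>x. c) = (\<lambda>x. 0)" for b :: 'a
    by (simp add: partial_deriv_def fun_eq_iff frechet_derivative_const)
  then show ?case using Suc by simp
qed simp

lemma C_k_add: "C_k n f \<Longrightarrow> C_k n g \<Longrightarrow> C_k n (\<lambda>x. f x + g x)"
proof (induction n arbitrary: f g)
  case (Suc n)
  have "partial_deriv b (\<lambda>x. f x + g x) = (\<lambda>x. partial_deriv b f x + partial_deriv b g x)" for b
  proof
    fix x
    have "((\<lambda>x. f x + g x) has_derivative
        (\<lambda>v. frechet_derivative f (at x) v + frechet_derivative g (at x) v)) (at x)"
      by (intro has_derivative_add frechet_derivative_works[THEN iffD1] C_k_differentiable[of n] Suc.prems)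
    from frechet_derivative_at[OF this]
    show "partial_deriv b (\<lambda>x. f x + g x) x = partial_deriv b f x + partial_deriv b g x"
      unfolding partial_deriv_def by (rule fun_cong[OF sym])
  qed
  then show ?case using Suc by simp
qed (simp add: continuous_on_add)

lemma C_k_mult: "C_k n f \<Longrightarrow> C_k n g \<Longrightarrow> C_k n (\<lambda>x. f x * g x)"
proof (induction n arbitrary: f g)
  case (Suc n)
  have "partial_deriv b (\<lambda>x. f x * g x)
          = (\<lambda>x. f x * partial_deriv b g x + partial_deriv b f x * g x)" for b
  proof
    fix x
    have "((\<lambda>x. f x * g x) has_derivative
        (\<lambda>v. f x * frechet_derivative g (at x) v + frechet_derivative f (at x) v * g x)) (at x)"
      by (intro has_derivative_mult frechet_derivative_works[THEN iffD1] C_k_differentiable[of n] Suc.prems)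
    from frechet_derivative_at[OF this]
    show "partial_deriv b (\<lambda>x. f x * g x) x = f x * partial_deriv b g x + partial_deriv b f x * g x"
      unfolding partial_deriv_def by (rule fun_cong[OF sym])
  qed
  moreover have "C_k n (\<lambda>x. f x * partial_deriv b g x + partial_deriv b f x * g x)"
    if "b \<in> Basis" for b
    using Suc.prems that
    by (intro C_k_add Suc.IH) (auto intro: C_k_Suc_imp_C_k)
  ultimately show ?case using Suc.prems by simp
qed (simp add: continuous_on_mult)

lemma C_k_prod:
  assumes "finite I" "\<And>i. i \<in> I \<Longrightarrow> C_k n (f i)"
  shows "C_k n (\<lambda>x. \<Prod>i\<in>I. f i x)"
  using assms by (induction I rule: finite_induct) (auto intro: C_k_const C_k_mult)

text \<open>Induction for all \<open>j\<close> at once: a partial derivative is a linear combination of the members \<open>j + 1\<close> and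
  \<open>j + 2\<close> of the same family.\<close>

lemma C_k_flat_affine: "C_k n (\<lambda>x. flat j (x \<bullet> v + c))"
proof (induction n arbitrary: j)
  case 0
  have "continuous_on UNIV (flat j)"
    using flat_has_real_derivative
    by (intro continuous_at_imp_continuous_on) (auto intro: DERIV_isCont)
  then show ?case
    by (auto intro!: continuous_on_compose2[of UNIV "flat j"] continuous_intros)
next
  case (Suc n)
  define D where "D x = flat (j + 2) (x \<bullet> v + c) + (- real j) * flat (j + 1) (x \<bullet> v + c)" for x
  have der: "((\<lambda>x. flat j (x \<bullet> v + c)) has_derivative (\<lambda>h. D x * (h \<bullet> v))) (at x)" for x
  proof -
    have "((\<lambda>x. x \<bullet> v + c) has_derivative (\<lambda>h. h \<bullet> v)) (at x)"
      by (auto intro!: derivative_eq_intros)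
    from DERIV_compose_FDERIV[OF flat_has_real_derivative this]
    show ?thesis by (simp add: D_def mult.commute)
  qed
  have "partial_deriv b (\<lambda>x. flat j (x \<bullet> v + c)) = (\<lambda>x. D x * (b \<bullet> v))" for b
    unfolding partial_deriv_def fun_eq_iff
    using frechet_derivative_at[OF der] by metis
  moreover have "C_k n D"
    unfolding D_def by (intro C_k_add C_k_mult C_k_const Suc)
  then have "C_k n (\<lambda>x. D x * (b \<bullet> v))" for b
    by (intro C_k_mult C_k_const)
  ultimately show ?case
    using der by (auto simp: differentiable_def)
qed

text \<open>
  A product of two steepened one-dimensional cut-offs in each coordinate, positive exactly on the
  open box and tending to its indicator as \<open>m\<close> grows.
\<close>

definition box_bump :: "'a::euclidean_space \<Rightarrow> 'a \<Rightarrow> nat \<Rightarrow> 'a \<Rightarrow> real" where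
  "box_bump a b m x = (\<Prod>i\<in>Basis. flat 0 (real (Suc m) * (x \<bullet> i - a \<bullet> i)) *
                                  flat 0 (real (Suc m) * (b \<bullet> i - x \<bullet> i)))"

lemma box_bump_eq_0_iff: "box_bump a b m x = 0 \<longleftrightarrow> x \<notin> box a b"
proof -
  have "real (Suc m) * y \<le> 0 \<longleftrightarrow> y \<le> 0" for y
    by (simp add: mult_le_0_iff)
  then show ?thesis
    by (auto simp add: box_bump_def flat_eq_0_iff mem_box not_less simp del: of_nat_Suc)
qed

lemma box_bump_test_function:
  assumes "cbox a b \<subseteq> \<Omega>"
  shows "box_bump a b m \<in> test_functions \<Omega>"
proof -
  have "C_k n (box_bump a b m)" for n
  proof -
    have "C_k n (\<lambda>x. \<Prod>i\<in>Basis. flat 0 (x \<bullet> (real (Suc m) *\<^sub>R i) + (- real (Suc m) * (a \<bullet> i))) *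
                             flat 0 (x \<bullet> (- real (Suc m) *\<^sub>R i) + real (Suc m) * (b \<bullet> i)))"
      by (intro C_k_prod C_k_mult C_k_flat_affine) auto
    then show ?thesis
      by (simp add: box_bump_def[abs_def] algebra_simps)
  qed
  moreover have "closure {x. box_bump a b m x \<noteq> 0} \<subseteq> cbox a b"
    by (rule closure_minimal) (auto simp: box_bump_eq_0_iff mem_box less_imp_le)
  moreover from this have "compact (closure {x. box_bump a b m x \<noteq> 0})"
    by (meson bounded_cbox bounded_subset closed_closure compact_eq_bounded_closed)
  ultimately show ?thesis
    using assms by (auto simp: test_functions_def)
qed

lemma box_bump_nonneg: "0 \<le> box_bump a b m x"
  unfolding box_bump_def by (intro prod_nonneg mult_nonneg_nonneg flat_nonneg ballI)

lemma box_bump_le_1: "box_bump a b m x \<le> 1"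
  unfolding box_bump_def by (intro prod_le_1 conjI mult_nonneg_nonneg flat_nonneg mult_le_one flat_0_le_1)

lemma box_bump_tendsto_indicator: "(\<lambda>m. box_bump a b m x) \<longlonglongrightarrow> indicator (box a b) x"
proof -
  have "(\<lambda>m. box_bump a b m x) \<longlonglongrightarrow>
    (\<Prod>i\<in>Basis. (if x \<bullet> i - a \<bullet> i > 0 then 1 else 0) * (if b \<bullet> i - x \<bullet> i > 0 then 1 else 0))"
    unfolding box_bump_def by (intro tendsto_prod tendsto_mult flat_0_scaled_tendsto)
  also have "(\<Prod>i\<in>Basis. (if x \<bullet> i - a \<bullet> i > 0 then 1 else 0) * (if b \<bullet> i - x \<bullet> i > 0 then 1 else 0))
    = (indicator (box a b) x :: real)"
  proof (cases "x \<in> box a b")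
    case True
    then show ?thesis by (simp add: mem_box)
  next
    case False
    then obtain i where "i \<in> Basis" "\<not> (a \<bullet> i < x \<bullet> i \<and> x \<bullet> i < b \<bullet> i)"
      by (auto simp: mem_box)
    then have "(\<Prod>i\<in>Basis. (if x \<bullet> i - a \<bullet> i > 0 then 1 else 0) * (if b \<bullet> i - x \<bullet> i > 0 then 1 else 0)) = (0::real)"
      by (intro prod_zero) auto
    then show ?thesis using False by simp
  qed
  finally show ?thesis .
qed

section \<open>Uniqueness of the weak gradient\<close>

text \<open>Boxes are stable under intersection and generate the Borel sets, so by Dynkin's argument all
  Borel integrals vanish. Taking complements requires the total integral to vanish too. Passing to
  a Borel representative of \<open>g\<close> avoids integrals over non-Borel Lebesgue sets.\<close>

lemma AE_eq_0_if_box_integrals_eq_0: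
  fixes g :: "'a::euclidean_space \<Rightarrow> real"
  assumes int: "integrable lebesgue g"
    and UNIV0: "(LINT x|lebesgue. g x) = 0"
    and box0: "\<And>a b. (LINT x:box a b|lebesgue. g x) = 0"
  shows "AE x in lebesgue. g x = 0"
proof -
  have set_int: "set_integrable lebesgue A g" if "A \<in> sets lebesgue" for A
    using int that unfolding set_integrable_def by (rule integrable_mult_indicator[rotated])
  have borel0: "(LINT x:A|lebesgue. g x) = 0" if "A \<in> sets borel" for A
  proof -
    have "Int_stable (range (\<lambda>(a, b). box a b :: 'a set))"
      by (auto simp: Int_stable_def box_Int_box)
    moreover have "range (\<lambda>(a, b). box a b :: 'a set) \<subseteq> Pow UNIV"
      by auto
    moreover have "A \<in> sigma_sets UNIV (range (\<lambda>(a, b). box a b))"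
      using that unfolding borel_eq_box by simp
    ultimately show ?thesis
    proof (induction rule: sigma_sets_induct_disjoint)
      case (basic A)
      then show ?case using box0 by auto
    next
      case empty
      then show ?case by (simp add: set_lebesgue_integral_def)
    next
      case (compl A)
      then have A: "A \<in> sets lebesgue"
        by (simp add: borel_eq_box)
      have "(LINT x:A \<union> (UNIV - A)|lebesgue. g x) = (LINT x:A|lebesgue. g x) + (LINT x:(UNIV - A)|lebesgue. g x)"
        using A by (intro set_integral_Un set_int) auto
      moreover have "A \<union> (UNIV - A) = UNIV" by auto
      ultimately show ?case
        using compl UNIV0 by (simp add: set_lebesgue_integral_def)
    next
      case (union F)
      then have F: "F i \<in> sets lebesgue" for i
        by (auto simp: borel_eq_box subset_eq)
      have "(LINT x:(\<Union>i. F i)|lebesgue. g x) = (\<Sum>i. (LINT x:(F i)|lebesgue. g x))"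
        using F union(1) by (intro lebesgue_integral_countable_add set_int) (auto simp: disjoint_family_on_def)
      then show ?case using union by simp
    qed
  qed
  obtain g' where meas: "g' \<in> borel_measurable lborel" and eq: "AE x in lborel. g x = g' x"
    using completion_ex_borel_measurable_real[of g lborel] int by auto
  have eq': "AE x in lebesgue. g x = g' x"
    using eq by (rule AE_completion)
  have meas': "g' \<in> borel_measurable lebesgue"
    using meas by (rule measurable_completion)
  have "integrable lebesgue g'"
    using int integrable_cong_AE[OF borel_measurable_integrable[OF int] meas' eq'] by simp
  then have int': "integrable lborel g'"
    using meas by (simp add: integrable_completion)
  have "AE x in lborel. g' x = 0"
  proof (rule density_unique_real[OF int' integrable_zero])
    fix A :: "'a set" assume A: "A \<in> sets lborel"
    have "(LINT x:A|lborel. g' x) = (LINT x:A|lebesgue. g' x)"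
      unfolding set_lebesgue_integral_def
      using A meas by (intro integral_completion[symmetric] borel_measurable_scaleR) auto
    also have "\<dots> = (LINT x:A|lebesgue. g x)"
      unfolding set_lebesgue_integral_def using A eq' meas' int
      by (intro integral_cong_AE borel_measurable_scaleR borel_measurable_indicator)
        (auto elim: eventually_mono)
    also have "\<dots> = 0"
      using A by (intro borel0) simp
    finally show "(LINT x:A|lborel. g' x) = (LINT x:A|lborel. 0)"
      by simp
  qed
  then have "AE x in lborel. g x = 0"
    using eq by eventually_elim simp
  then show ?thesis
    by (rule AE_completion)
qed

lemma integrable_on_bounded_if_L2:
  assumes "bounded \<Omega>" "\<Omega> \<in> sets lebesgue" "f \<in> L2_space \<Omega>"
  shows "integrable (lebesgue_on \<Omega>) f"
proof -
  have "\<Omega> \<in> lmeasurable"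
    using assms(1,2) by (rule bounded_set_imp_lmeasurable)
  then interpret finite_measure "lebesgue_on \<Omega>"
    by (rule finite_measure_lebesgue_on)
  show ?thesis
  proof (rule Bochner_Integration.integrable_bound)
    show "integrable (lebesgue_on \<Omega>) (\<lambda>x. 1 + (norm (f x))\<^sup>2)"
      using assms(3) by (auto simp: L2_space_def)
    show "f \<in> borel_measurable (lebesgue_on \<Omega>)"
      using assms(3) by (simp add: L2_space_def)
    have "norm (f x) \<le> norm (1 + (norm (f x))\<^sup>2)" for x
    proof -
      have "2 * norm (f x) \<le> 1 + (norm (f x))\<^sup>2"
        using sum_squares_bound[of 1 "norm (f x)"] by simp
      moreover have "norm (1 + (norm (f x))\<^sup>2) = 1 + (norm (f x))\<^sup>2"
        by simp
      ultimately show ?thesis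
        using norm_ge_zero[of "f x"] by linarith
    qed
    then show "AE x in lebesgue_on \<Omega>. norm (f x) \<le> norm (1 + (norm (f x))\<^sup>2)"
      by simp
  qed
qed

text \<open>By dominated convergence the bump functions give vanishing integrals over boxes whose closure lies
  in \<open>\<Omega>\<close>. Inside one such box \<open>B\<close> every intersection with a box is again one, so \<open>g\<close> times the
  indicator of \<open>B\<close> has vanishing integral over all boxes. Countably many such boxes cover \<open>\<Omega>\<close>.\<close>

lemma fundamental_lemma:
  fixes g :: "'a::euclidean_space \<Rightarrow> real"
  assumes "open \<Omega>" and int: "integrable (lebesgue_on \<Omega>) g"
    and test0: "\<And>\<phi>. \<phi> \<in> test_functions \<Omega> \<Longrightarrow> (LINT x|lebesgue_on \<Omega>. g x * \<phi> x) = 0"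
  shows "AE x in lebesgue_on \<Omega>. g x = 0"
proof -
  have [simp]: "\<Omega> \<in> sets lebesgue"
    using assms(1) by simp
  have box_int: "(LINT x|lebesgue_on \<Omega>. g x * indicator (box a b) x) = 0" if "cbox a b \<subseteq> \<Omega>" for a b
  proof (rule LIMSEQ_unique)
    show "(\<lambda>m. LINT x|lebesgue_on \<Omega>. g x * box_bump a b m x) \<longlonglongrightarrow> (LINT x|lebesgue_on \<Omega>. g x * indicator (box a b) x)"
    proof (rule integral_dominated_convergence[where w = "\<lambda>x. norm (g x)"])
      show "(\<lambda>x. g x * indicator (box a b) x) \<in> borel_measurable (lebesgue_on \<Omega>)"
        using int by (intro borel_measurable_times measurable_restrict_space1[OF borel_measurable_indicator]) auto
      have "continuous_on UNIV (box_bump a b m)" for m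
        using box_bump_test_function[OF that, of m] unfolding test_functions_def by (metis (mono_tags, lifting) C_k.simps(1) mem_Collect_eq)
      then show "(\<lambda>x. g x * box_bump a b m x) \<in> borel_measurable (lebesgue_on \<Omega>)" for m
        using int by (intro borel_measurable_times)
          (auto intro!: measurable_restrict_space1 measurable_completion borel_measurable_continuous_onI)
      show "integrable (lebesgue_on \<Omega>) (\<lambda>x. norm (g x))"
        using int by simp
      show "AE x in lebesgue_on \<Omega>. (\<lambda>m. g x * box_bump a b m x) \<longlonglongrightarrow> g x * indicator (box a b) x"
        by (intro AE_I2 tendsto_mult tendsto_const box_bump_tendsto_indicator)
      show "AE x in lebesgue_on \<Omega>. norm (g x * box_bump a b m x) \<le> norm (g x)" for m
        using box_bump_nonneg[of a b m] box_bump_le_1[of a b m]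
        by (intro AE_I2) (simp add: abs_mult mult_left_le)
    qed
    show "(\<lambda>m. LINT x|lebesgue_on \<Omega>. g x * box_bump a b m x) \<longlonglongrightarrow> 0"
      using test0[OF box_bump_test_function[OF that]] by simp
  qed
  have cbox_AE: "AE x in lebesgue. x \<in> cbox c d \<longrightarrow> g x = 0" if cd: "cbox c d \<subseteq> \<Omega>" for c d
  proof -
    have sub: "(LINT x|lebesgue. indicator (box c d \<inter> box a b) x * g x) = 0" for a b
    proof -
      obtain a' b' where ab': "box c d \<inter> box a b = box a' b'" "cbox a' b' \<subseteq> cbox c d"
      proof
        show "box c d \<inter> box a b = box (\<Sum>i\<in>Basis. max (c \<bullet> i) (a \<bullet> i) *\<^sub>R i) (\<Sum>i\<in>Basis. min (d \<bullet> i) (b \<bullet> i) *\<^sub>R i)"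
          by (rule box_Int_box)
        show "cbox (\<Sum>i\<in>Basis. max (c \<bullet> i) (a \<bullet> i) *\<^sub>R i) (\<Sum>i\<in>Basis. min (d \<bullet> i) (b \<bullet> i) *\<^sub>R i) \<subseteq> cbox c d"
          by (rule subset_box_imp(1)) simp
      qed
      have "(LINT x|lebesgue. indicator \<Omega> x *\<^sub>R (g x * indicator (box a' b') x)) = 0"
        using box_int[of a' b'] ab' cd by (subst integral_restrict_space[symmetric]) auto
      moreover have "indicator \<Omega> x *\<^sub>R (g x * indicator (box a' b') x) = indicator (box c d \<inter> box a b) x * g x" for x
        using ab' cd box_subset_cbox[of a' b'] by (auto simp: indicator_def)
      ultimately show ?thesis by (simp only:)
    qed
    have "AE x in lebesgue. indicator (box c d) x * g x = 0"
    proof (rule AE_eq_0_if_box_integrals_eq_0)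
      have "integrable lebesgue (\<lambda>x. indicator \<Omega> x *\<^sub>R g x)"
        using int by (subst (asm) integrable_restrict_space) auto
      then have "integrable lebesgue (\<lambda>x. indicator (box c d) x *\<^sub>R (indicator \<Omega> x *\<^sub>R g x))"
        by (rule integrable_mult_indicator[rotated]) simp
      moreover have "indicator (box c d) x *\<^sub>R (indicator \<Omega> x *\<^sub>R g x) = indicator (box c d) x * g x" for x
        using cd box_subset_cbox[of c d] by (auto simp: indicator_def)
      ultimately show "integrable lebesgue (\<lambda>x. indicator (box c d) x * g x)" by (simp only:)
      show "(LINT x|lebesgue. indicator (box c d) x * g x) = 0"
        using sub[of c d] by simp
      show "(LINT x:box a b|lebesgue. indicator (box c d) x * g x) = 0" for a b
        using sub[of a b] by (simp add: set_lebesgue_integral_def indicator_inter_arith mult_ac)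
    qed
    moreover have "AE x in lebesgue. x \<notin> cbox c d - box c d"
      using negligible_frontier_interval[of c d] by (intro AE_not_in) (simp add: negligible_iff_null_sets)
    ultimately show ?thesis
      by eventually_elim (auto simp: indicator_def)
  qed
  obtain D where D: "countable D" "D \<subseteq> Pow \<Omega>" "\<And>X. X \<in> D \<Longrightarrow> \<exists>a b. X = cbox a b" "\<Union>D = \<Omega>"
    using open_countable_Union_open_cbox[OF assms(1)] by blast
  have "AE x in lebesgue. \<forall>X\<in>D. x \<in> X \<longrightarrow> g x = 0"
    using D(1-3) cbox_AE by (subst AE_ball_countable) blast+
  then show ?thesis
    using D(4) by (subst AE_restrict_space_iff) (auto elim: eventually_mono)
qed


text \<open>Both functions are continuous and vanish off the compact support; for the derivative this holds
  because the complement of the support is open. Hence they may be paired with any element of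
  \<open>L\<^sup>2(\<Omega>)\<close>.\<close>

lemma test_function_L2_space:
  assumes "\<Omega> \<in> sets lebesgue" "\<phi> \<in> test_functions \<Omega>"
  shows "\<phi> \<in> L2_space \<Omega>" and "b \<in> Basis \<Longrightarrow> partial_deriv b \<phi> \<in> L2_space \<Omega>"
proof -
  define S where "S = closure {x. \<phi> x \<noteq> 0}"
  have S: "compact S" and C: "C_k n \<phi>" for n
    using assms(2) by (auto simp: test_functions_def S_def)
  have L2: "f \<in> L2_space \<Omega>" if cont: "continuous_on UNIV f" and 0: "\<And>x. x \<notin> S \<Longrightarrow> f x = 0"
    for f :: "'a \<Rightarrow> real"
  proof -
    have "bounded (f ` S)"
      using S cont by (intro compact_imp_bounded compact_continuous_image) (auto intro: continuous_on_subset)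
    then obtain B where B: "\<And>x. x \<in> S \<Longrightarrow> \<bar>f x\<bar> \<le> B"
      by (auto simp: bounded_iff)
    have meas: "f \<in> borel_measurable (lebesgue_on \<Omega>)"
      using cont by (auto intro!: measurable_restrict_space1 measurable_completion borel_measurable_continuous_onI)
    have "integrable (lebesgue_on \<Omega>) (\<lambda>x. (norm (f x))\<^sup>2)"
    proof (rule Bochner_Integration.integrable_bound)
      have "integrable lebesgue (indicator S :: 'a \<Rightarrow> real)"
        using lmeasurable_compact[OF S] by (intro integrable_real_indicator) (auto simp: fmeasurable_def)
      then have "integrable lebesgue (\<lambda>x. B\<^sup>2 * indicator S x)"
        by simp
      then show "integrable (lebesgue_on \<Omega>) (\<lambda>x. B\<^sup>2 * indicator S x)"
        using assms(1) integrable_mult_indicator[of \<Omega> lebesgue "\<lambda>x. B\<^sup>2 * indicator S x"]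
        by (subst integrable_restrict_space) auto
      show "(\<lambda>x. (norm (f x))\<^sup>2) \<in> borel_measurable (lebesgue_on \<Omega>)"
        using meas by simp
      have "(f x)\<^sup>2 \<le> B\<^sup>2" if "x \<in> S" for x
        using B[OF that] by (simp add: abs_le_square_iff[symmetric])
      then have "norm ((norm (f x))\<^sup>2) \<le> norm (B\<^sup>2 * indicator S x)" for x
        using 0[of x] by (cases "x \<in> S") auto
      then show "AE x in lebesgue_on \<Omega>. norm ((norm (f x))\<^sup>2) \<le> norm (B\<^sup>2 * indicator S x)"
        by simp
    qed
    then show ?thesis
      using meas by (simp add: L2_space_def)
  qed
  have "x \<in> S" if "\<phi> x \<noteq> 0" for x
    using that closure_subset[of "{x. \<phi> x \<noteq> 0}"] by (auto simp: S_def)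
  then have \<phi>0: "\<phi> x = 0" if "x \<notin> S" for x
    using that by blast
  show "\<phi> \<in> L2_space \<Omega>"
    using C[of 0] \<phi>0 by (intro L2) auto
  assume "b \<in> Basis"
  show "partial_deriv b \<phi> \<in> L2_space \<Omega>"
  proof (rule L2)
    show "continuous_on UNIV (partial_deriv b \<phi>)"
      using C[of "Suc 0"] \<open>b \<in> Basis\<close> by simp
    fix x assume "x \<notin> S"
    then have "((\<lambda>_. 0) has_derivative (\<lambda>_. 0)) (at x)" "open (- S)" "x \<in> - S"
      using S by (auto simp: compact_imp_closed)
    then have "(\<phi> has_derivative (\<lambda>_. 0)) (at x)"
      using \<phi>0 has_derivative_transform_within_open[of "\<lambda>_. 0" "\<lambda>_. 0" x UNIV "- S" \<phi>] by auto
    then show "partial_deriv b \<phi> x = 0"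
      using frechet_derivative_at by (metis partial_deriv_def)
  qed
qed

lemma L2_space_inner_const:
  assumes "g \<in> L2_space \<Omega>"
  shows "(\<lambda>x. g x \<bullet> b) \<in> L2_space \<Omega>"
proof -
  have "integrable (lebesgue_on \<Omega>) (\<lambda>x. (norm (g x \<bullet> b))\<^sup>2)"
  proof (rule Bochner_Integration.integrable_bound)
    show "integrable (lebesgue_on \<Omega>) (\<lambda>x. (norm b)\<^sup>2 * (norm (g x))\<^sup>2)"
      using assms by (auto simp: L2_space_def)
    show "(\<lambda>x. (norm (g x \<bullet> b))\<^sup>2) \<in> borel_measurable (lebesgue_on \<Omega>)"
      using assms by (auto simp: L2_space_def)
    have "(norm (g x \<bullet> b))\<^sup>2 \<le> (norm (g x) * norm b)\<^sup>2" for x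
      using Cauchy_Schwarz_ineq2[of "g x" b] by (intro power_mono) auto
    then have "norm ((norm (g x \<bullet> b))\<^sup>2) \<le> norm ((norm b)\<^sup>2 * (norm (g x))\<^sup>2)" for x
      by (simp add: power_mult_distrib mult.commute)
    then show "AE x in lebesgue_on \<Omega>. norm ((norm (g x \<bullet> b))\<^sup>2) \<le> norm ((norm b)\<^sup>2 * (norm (g x))\<^sup>2)"
      by simp
  qed
  then show ?thesis
    using assms by (auto simp: L2_space_def)
qed

lemma has_weak_gradient_diff:
  assumes "\<Omega> \<in> sets lebesgue"
    and "u \<in> L2_space \<Omega>" "v \<in> L2_space \<Omega>" "g \<in> L2_space \<Omega>" "h \<in> L2_space \<Omega>"
    and "has_weak_gradient \<Omega> u g" "has_weak_gradient \<Omega> v h"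
  shows "has_weak_gradient \<Omega> (\<lambda>x. u x - v x) (\<lambda>x. g x - h x)"
  unfolding has_weak_gradient_def
proof (intro ballI)
  fix \<phi> and b :: 'a assume \<phi>: "\<phi> \<in> test_functions \<Omega>" and b: "b \<in> Basis"
  note t = test_function_L2_space(1)[OF assms(1) \<phi>] test_function_L2_space(2)[OF assms(1) \<phi> b]
  have i: "integrable (lebesgue_on \<Omega>) (\<lambda>x. u x * partial_deriv b \<phi> x)"
          "integrable (lebesgue_on \<Omega>) (\<lambda>x. v x * partial_deriv b \<phi> x)"
          "integrable (lebesgue_on \<Omega>) (\<lambda>x. (g x \<bullet> b) * \<phi> x)"
          "integrable (lebesgue_on \<Omega>) (\<lambda>x. (h x \<bullet> b) * \<phi> x)"
    using L2_space_integrable_inner[OF assms(2) t(2)] L2_space_integrable_inner[OF assms(3) t(2)]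
      L2_space_integrable_inner[OF L2_space_inner_const[OF assms(4)] t(1)]
      L2_space_integrable_inner[OF L2_space_inner_const[OF assms(5)] t(1)]
    by auto
  show "(LINT x|lebesgue_on \<Omega>. (u x - v x) * partial_deriv b \<phi> x)
          = - (LINT x|lebesgue_on \<Omega>. ((g x - h x) \<bullet> b) * \<phi> x)"
    using assms(6,7) \<phi> b i
    by (simp add: has_weak_gradient_def left_diff_distrib inner_diff_left)
qed

lemma has_weak_gradient_unique:
  assumes "open \<Omega>" "bounded \<Omega>"
    and "g \<in> L2_space \<Omega>" "h \<in> L2_space \<Omega>"
    and "has_weak_gradient \<Omega> u g" "has_weak_gradient \<Omega> u h"
  shows "AE x in lebesgue_on \<Omega>. g x = h x"
proof -
  have \<Omega>: "\<Omega> \<in> sets lebesgue"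
    using assms(1) by simp
  have "AE x in lebesgue_on \<Omega>. (g x - h x) \<bullet> b = 0" if b: "b \<in> Basis" for b
  proof (rule fundamental_lemma[OF assms(1)])
    show "integrable (lebesgue_on \<Omega>) (\<lambda>x. (g x - h x) \<bullet> b)"
      by (intro integrable_on_bounded_if_L2 L2_space_inner_const L2_space_diff assms \<Omega>)
    fix \<phi> assume \<phi>: "\<phi> \<in> test_functions \<Omega>"
    note t = test_function_L2_space(1)[OF \<Omega> \<phi>]
    have "integrable (lebesgue_on \<Omega>) (\<lambda>x. (g x \<bullet> b) * \<phi> x)"
         "integrable (lebesgue_on \<Omega>) (\<lambda>x. (h x \<bullet> b) * \<phi> x)"
      using L2_space_integrable_inner[OF L2_space_inner_const[OF assms(3)] t]
        L2_space_integrable_inner[OF L2_space_inner_const[OF assms(4)] t]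
      by auto
    then show "(LINT x|lebesgue_on \<Omega>. ((g x - h x) \<bullet> b) * \<phi> x) = 0"
      using assms(5,6) \<phi> b
      by (simp add: has_weak_gradient_def left_diff_distrib inner_diff_left)
  qed
  then have "AE x in lebesgue_on \<Omega>. \<forall>b\<in>Basis. (g x - h x) \<bullet> b = 0"
    by (subst AE_ball_countable) (auto intro: countable_finite)
  then show ?thesis
    by eventually_elim (metis eq_iff_diff_eq_0 euclidean_all_zero_iff)
qed

lemma weak_gradient_works:
  assumes "u \<in> H1_space \<Omega>"
  shows "weak_gradient \<Omega> u \<in> L2_space \<Omega>" "has_weak_gradient \<Omega> u (weak_gradient \<Omega> u)"
  using someI_ex[of "\<lambda>g. g \<in> L2_space \<Omega> \<and> has_weak_gradient \<Omega> u g"] assms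
  by (auto simp: H1_space_def weak_gradient_def)

text \<open>The choice of weak gradient is not linear pointwise; uniqueness makes it linear up to null sets,
  which the norm does not see.\<close>

lemma L2_norm_weak_gradient_diff:
  assumes "open \<Omega>" "bounded \<Omega>" "u \<in> H1_space \<Omega>" "v \<in> H1_space \<Omega>"
  shows "L2_norm \<Omega> (\<lambda>x. weak_gradient \<Omega> u x - weak_gradient \<Omega> v x)
           = L2_norm \<Omega> (weak_gradient \<Omega> (\<lambda>x. u x - v x))"
proof -
  note wu = weak_gradient_works[OF assms(3)] and wv = weak_gradient_works[OF assms(4)]
  have L2: "u \<in> L2_space \<Omega>" "v \<in> L2_space \<Omega>"
    using assms by (auto simp: H1_space_def)
  have d: "has_weak_gradient \<Omega> (\<lambda>x. u x - v x) (\<lambda>x. weak_gradient \<Omega> u x - weak_gradient \<Omega> v x)"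
    using L2 wu wv assms(1) by (intro has_weak_gradient_diff) auto
  have dL2: "(\<lambda>x. weak_gradient \<Omega> u x - weak_gradient \<Omega> v x) \<in> L2_space \<Omega>"
    using wu wv by (intro L2_space_diff)
  have "(\<lambda>x. u x - v x) \<in> H1_space \<Omega>"
    using L2_space_diff[OF L2] d dL2 by (auto simp: H1_space_def)
  note w = weak_gradient_works[OF this]
  have "AE x in lebesgue_on \<Omega>. weak_gradient \<Omega> u x - weak_gradient \<Omega> v x
                                 = weak_gradient \<Omega> (\<lambda>x. u x - v x) x"
    by (rule has_weak_gradient_unique[OF assms(1,2) dL2 w(1) d w(2)])
  then have "(LINT x|lebesgue_on \<Omega>. (norm (weak_gradient \<Omega> u x - weak_gradient \<Omega> v x))\<^sup>2)
      = (LINT x|lebesgue_on \<Omega>. (norm (weak_gradient \<Omega> (\<lambda>x. u x - v x) x))\<^sup>2)"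
    using dL2 w(1) by (intro integral_cong_AE) (auto simp: L2_space_def elim: eventually_mono)
  then show ?thesis
    by (simp add: L2_norm_def)
qed

section \<open>Curves of finite energy and the energy identity\<close>

lemma finite_energy_curveD:
  assumes "finite_energy_curve \<Omega> z z'" "0 \<le> t"
  shows "z t \<in> H10_space \<Omega>" "z t \<in> H1_space \<Omega>" "z t \<in> L2_space \<Omega>" "z' t \<in> L2_space \<Omega>"
    and "weak_gradient \<Omega> (z t) \<in> L2_space \<Omega>"
    and "((\<lambda>s. H1_norm \<Omega> (\<lambda>x. z s x - z t x)) \<longlongrightarrow> 0) (at t within {0..})"
    and "((\<lambda>s. L2_norm \<Omega> (\<lambda>x. (z s x - z t x) / (s - t) - z' t x)) \<longlongrightarrow> 0) (at t within {0..})"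
    and "((\<lambda>s. L2_norm \<Omega> (\<lambda>x. z' s x - z' t x)) \<longlongrightarrow> 0) (at t within {0..})"
proof -
  show "z t \<in> H10_space \<Omega>"
    using assms by (simp add: finite_energy_curve_def)
  then show "z t \<in> H1_space \<Omega>"
    by (simp add: H10_space_def)
  then show "z t \<in> L2_space \<Omega>" "weak_gradient \<Omega> (z t) \<in> L2_space \<Omega>"
    by (auto simp: H1_space_def weak_gradient_works)
  show "z' t \<in> L2_space \<Omega>"
    "((\<lambda>s. H1_norm \<Omega> (\<lambda>x. z s x - z t x)) \<longlongrightarrow> 0) (at t within {0..})"
    "((\<lambda>s. L2_norm \<Omega> (\<lambda>x. (z s x - z t x) / (s - t) - z' t x)) \<longlongrightarrow> 0) (at t within {0..})"
    "((\<lambda>s. L2_norm \<Omega> (\<lambda>x. z' s x - z' t x)) \<longlongrightarrow> 0) (at t within {0..})"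
    using assms by (auto simp: finite_energy_curve_def curve_continuous_def curve_has_derivative_def)
qed

lemma L2_norm_le_H1_norm: "L2_norm \<Omega> u \<le> H1_norm \<Omega> u"
  and L2_norm_weak_gradient_le_H1_norm: "L2_norm \<Omega> (weak_gradient \<Omega> u) \<le> H1_norm \<Omega> u"
  unfolding H1_norm_def by (rule real_le_rsqrt; simp)+

lemma finite_energy_curve_tendsto_L2:
  assumes "finite_energy_curve \<Omega> z z'" "0 \<le> t"
  shows "((\<lambda>s. L2_norm \<Omega> (\<lambda>x. z s x - z t x)) \<longlongrightarrow> 0) (at t within {0..})"
  by (rule Lim_null_comparison[OF _ finite_energy_curveD(6)[OF assms]])
    (simp add: L2_norm_le_H1_norm)

lemma continuous_on_L2_norm:
  fixes f :: "real \<Rightarrow> 'a::euclidean_space \<Rightarrow> 'b::euclidean_space"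
  assumes "\<And>t. 0 \<le> t \<Longrightarrow> f t \<in> L2_space \<Omega>"
    and "\<And>t. 0 \<le> t \<Longrightarrow> ((\<lambda>s. L2_norm \<Omega> (\<lambda>x. f s x - f t x)) \<longlongrightarrow> 0) (at t within {0..})"
  shows "continuous_on {0..} (\<lambda>t. L2_norm \<Omega> (f t))"
  unfolding continuous_on_def
proof (intro ballI)
  fix t :: real assume t: "t \<in> {0..}"
  show "((\<lambda>t. L2_norm \<Omega> (f t)) \<longlongrightarrow> L2_norm \<Omega> (f t)) (at t within {0..})"
  proof (rule Lim_null[THEN iffD2], rule Lim_null_comparison)
    show "((\<lambda>s. L2_norm \<Omega> (\<lambda>x. f s x - f t x)) \<longlongrightarrow> 0) (at t within {0..})"
      using assms(2) t by simp
    show "\<forall>\<^sub>F s in at t within {0..}. norm (L2_norm \<Omega> (f s) - L2_norm \<Omega> (f t)) \<le> L2_norm \<Omega> (\<lambda>x. f s x - f t x)"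
      using t assms(1) by (auto simp: eventually_at_filter intro!: always_eventually L2_norm_diff_ineq)
  qed
qed

lemma finite_energy_curve_continuous_norms:
  assumes fin: "finite_energy_curve \<Omega> z z'" and "open \<Omega>" "bounded \<Omega>"
  shows "continuous_on {0..} (\<lambda>t. L2_norm \<Omega> (z t))"
    and "continuous_on {0..} (\<lambda>t. L2_norm \<Omega> (z' t))"
    and "continuous_on {0..} (\<lambda>t. L2_norm \<Omega> (weak_gradient \<Omega> (z t)))"
proof -
  note F = finite_energy_curveD[OF fin]
  show "continuous_on {0..} (\<lambda>t. L2_norm \<Omega> (z t))"
    using F(3) finite_energy_curve_tendsto_L2[OF fin] by (rule continuous_on_L2_norm)
  show "continuous_on {0..} (\<lambda>t. L2_norm \<Omega> (z' t))"
    using F(4,8) by (rule continuous_on_L2_norm)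
  show "continuous_on {0..} (\<lambda>t. L2_norm \<Omega> (weak_gradient \<Omega> (z t)))"
  proof (rule continuous_on_L2_norm[OF F(5)])
    fix t :: real assume t: "0 \<le> t"
    show "((\<lambda>s. L2_norm \<Omega> (\<lambda>x. weak_gradient \<Omega> (z s) x - weak_gradient \<Omega> (z t) x)) \<longlongrightarrow> 0) (at t within {0..})"
    proof (rule Lim_null_comparison[OF _ F(6)[OF t]])
      show "\<forall>\<^sub>F s in at t within {0..}.
          norm (L2_norm \<Omega> (\<lambda>x. weak_gradient \<Omega> (z s) x - weak_gradient \<Omega> (z t) x)) \<le> H1_norm \<Omega> (\<lambda>x. z s x - z t x)"
        using t F(2) L2_norm_weak_gradient_diff[OF assms(2,3)]
        by (auto simp: eventually_at_filter L2_norm_weak_gradient_le_H1_norm intro!: always_eventually)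
    qed
  qed
qed

text \<open>Norm differentiability of the curve gives weak differentiability of the pairing with a fixed
  element.\<close>

lemma has_real_derivative_L2_inner_const:
  assumes "finite_energy_curve \<Omega> z z'" "f \<in> L2_space \<Omega>" "0 \<le> t"
  shows "((\<lambda>s. L2_inner \<Omega> f (z s)) has_real_derivative L2_inner \<Omega> f (z' t)) (at t within {0..})"
  unfolding has_field_derivative_iff
proof (rule Lim_transform_eventually)
  note F = finite_energy_curveD[OF assms(1)]
  show "((\<lambda>s. L2_inner \<Omega> f (\<lambda>x. (z s x - z t x) / (s - t))) \<longlongrightarrow> L2_inner \<Omega> f (z' t)) (at t within {0..})"
    using assms F(3,4) F(7)[OF assms(3)]
    by (intro tendsto_L2_inner L2_space_divide L2_space_diff) (auto simp: L2_norm_def)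
  show "\<forall>\<^sub>F s in at t within {0..}. L2_inner \<Omega> f (\<lambda>x. (z s x - z t x) / (s - t))
      = (L2_inner \<Omega> f (z s) - L2_inner \<Omega> f (z t)) / (s - t)"
    using assms(2,3) F(3)
    by (auto simp: eventually_at_filter L2_inner_divide_right L2_inner_diff_right intro!: always_eventually)
qed

text \<open>In the product rule for \<open>\<langle>z'(s+a), z(s+b)\<rangle>\<close> the difference quotient of \<open>z\<close> converges in \<open>L\<^sup>2\<close>, and the
  increment of \<open>z'\<close> is only paired with the fixed element \<open>z(t+b)\<close> of \<open>H\<^sup>1\<^sub>0(\<Omega>)\<close>, which is a legitimate
  test function. No differentiability of \<open>z'\<close> in \<open>L\<^sup>2\<close> is involved. The two shifts allow comparing the solution
  with its time translates.\<close>

lemma weak_wave_product_rule: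
  assumes fin: "finite_energy_curve \<Omega> z z'"
    and wave: "weak_wave_solution_on \<Omega> I f z z'"
    and J: "\<And>s. s \<in> J \<Longrightarrow> s + a \<in> I \<and> 0 \<le> s + a \<and> 0 \<le> s + b" and t: "t \<in> J"
  shows "((\<lambda>s. L2_inner \<Omega> (z' (s + a)) (z (s + b))) has_real_derivative
           L2_inner \<Omega> f (z (t + b)) - L2_inner \<Omega> (weak_gradient \<Omega> (z (t + a))) (weak_gradient \<Omega> (z (t + b)))
           + L2_inner \<Omega> (z' (t + a)) (z' (t + b))) (at t within J)"
proof -
  note F = finite_energy_curveD[OF fin]
  have shift: "filterlim (\<lambda>s. s + c) (at (t + c) within S) (at t within J)"
    if "\<And>s. s \<in> J \<Longrightarrow> s + c \<in> S" for c :: real and S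
    using that by (auto simp: filterlim_at eventually_at_filter intro!: tendsto_eq_intros always_eventually)
  define v where "v = z (t + b)"
  have vH: "v \<in> H10_space \<Omega>" and v: "v \<in> L2_space \<Omega>"
    using F J[OF t] by (auto simp: v_def)
  have 1: "((\<lambda>s. L2_inner \<Omega> (z' (s + a)) (\<lambda>x. (z (s + b) x - v x) / (s - t))) \<longlongrightarrow> L2_inner \<Omega> (z' (t + a)) (z' (t + b))) (at t within J)"
  proof (rule tendsto_L2_inner)
    show "((\<lambda>s. L2_norm \<Omega> (\<lambda>x. z' (s + a) x - z' (t + a) x)) \<longlongrightarrow> 0) (at t within J)"
      using J t by (intro filterlim_compose[OF F(8) shift]) auto
    have "((\<lambda>s. L2_norm \<Omega> (\<lambda>x. (z (s + b) x - z (t + b) x) / (s + b - (t + b)) - z' (t + b) x)) \<longlongrightarrow> 0) (at t within J)"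
      using J t by (intro filterlim_compose[OF F(7) shift]) auto
    then show "((\<lambda>s. L2_norm \<Omega> (\<lambda>x. (z (s + b) x - v x) / (s - t) - z' (t + b) x)) \<longlongrightarrow> 0) (at t within J)"
      by (simp add: v_def)
  qed (use J t F(3,4) v in \<open>auto intro!: L2_space_divide L2_space_diff\<close>)
  have "((\<lambda>s. L2_inner \<Omega> (z' s) v) has_real_derivative
           L2_inner \<Omega> f v - L2_inner \<Omega> (weak_gradient \<Omega> (z (t + a))) (weak_gradient \<Omega> v)) (at (t + a) within I)"
    using wave vH J[OF t] by (auto simp: weak_wave_solution_on_def)
  then have "((\<lambda>s. (L2_inner \<Omega> (z' s) v - L2_inner \<Omega> (z' (t + a)) v) / (s - (t + a))) \<longlongrightarrow>
           L2_inner \<Omega> f v - L2_inner \<Omega> (weak_gradient \<Omega> (z (t + a))) (weak_gradient \<Omega> v)) (at (t + a) within I)"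
    by (simp add: has_field_derivative_iff)
  then have "((\<lambda>s. (L2_inner \<Omega> (z' (s + a)) v - L2_inner \<Omega> (z' (t + a)) v) / (s + a - (t + a))) \<longlongrightarrow>
           L2_inner \<Omega> f v - L2_inner \<Omega> (weak_gradient \<Omega> (z (t + a))) (weak_gradient \<Omega> v)) (at t within J)"
    using J by (intro filterlim_compose[OF _ shift]) auto
  from tendsto_add[OF this 1]
  have lim: "((\<lambda>s. (L2_inner \<Omega> (z' (s + a)) v - L2_inner \<Omega> (z' (t + a)) v) / (s - t)
         + L2_inner \<Omega> (z' (s + a)) (\<lambda>x. (z (s + b) x - v x) / (s - t))) \<longlongrightarrow>
       L2_inner \<Omega> f v - L2_inner \<Omega> (weak_gradient \<Omega> (z (t + a))) (weak_gradient \<Omega> v)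
         + L2_inner \<Omega> (z' (t + a)) (z' (t + b))) (at t within J)"
    by simp
  have "((\<lambda>s. (L2_inner \<Omega> (z' (s + a)) (z (s + b)) - L2_inner \<Omega> (z' (t + a)) v) / (s - t)) \<longlongrightarrow>
       L2_inner \<Omega> f v - L2_inner \<Omega> (weak_gradient \<Omega> (z (t + a))) (weak_gradient \<Omega> v)
         + L2_inner \<Omega> (z' (t + a)) (z' (t + b))) (at t within J)"
  proof (rule Lim_transform_eventually[OF lim])
    have "L2_inner \<Omega> (z' (s + a)) (\<lambda>x. (z (s + b) x - v x) / (s - t))
        = (L2_inner \<Omega> (z' (s + a)) (z (s + b)) - L2_inner \<Omega> (z' (s + a)) v) / (s - t)" if "s \<in> J" for s
      using J[OF that] F(3)[of "s + b"] F(4)[of "s + a"] v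
      by (simp add: L2_inner_divide_right L2_inner_diff_right)
    then show "\<forall>\<^sub>F s in at t within J. (L2_inner \<Omega> (z' (s + a)) v - L2_inner \<Omega> (z' (t + a)) v) / (s - t)
         + L2_inner \<Omega> (z' (s + a)) (\<lambda>x. (z (s + b) x - v x) / (s - t))
       = (L2_inner \<Omega> (z' (s + a)) (z (s + b)) - L2_inner \<Omega> (z' (t + a)) v) / (s - t)"
      by (auto simp: eventually_at_filter add_divide_distrib[symmetric] intro!: always_eventually)
  qed
  then show ?thesis
    by (simp add: has_field_derivative_iff v_def)
qed

text \<open>
  Let \<open>G\<^sub>h(t) = \<langle>z'(t), z(t+h)\<rangle> - \<langle>z'(t+h), z(t)\<rangle>\<close>. In its derivative the terms \<open>\<langle>z'(t), z'(t+h)\<rangle>\<close> and the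
  Dirichlet form cancel by symmetry, leaving \<open>\<psi>(t+h) - \<psi>(t)\<close> with \<open>\<psi> = \<langle>f, z\<rangle>\<close>. As \<open>h \<rightarrow> 0+\<close>,
  \<open>G\<^sub>h(t)/h\<close> tends to \<open>\<parallel>z'\<parallel>\<^sup>2 - d/dt \<langle>z', v\<rangle>\<close> with \<open>v\<close> frozen at \<open>z(t)\<close>, which is \<open>2 E(t) - \<psi>(t)\<close> by the
  equation, while the integrated right-hand side divided by \<open>h\<close> tends to \<open>\<psi>(t) - \<psi>(s)\<close>. One-sided limits
  suffice, so the equation is needed on a half-open interval only.
\<close>

lemma energy_identity:
  assumes fin: "finite_energy_curve \<Omega> z z'" and f: "f \<in> L2_space \<Omega>"
    and wave: "weak_wave_solution_on \<Omega> I f z z'"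
    and I: "\<And>r. s \<le> r \<Longrightarrow> r < X \<Longrightarrow> r \<in> I" and st: "0 \<le> s" "s \<le> t" "t < X"
  shows "energy \<Omega> z z' t - energy \<Omega> z z' s = L2_inner \<Omega> f (z t) - L2_inner \<Omega> f (z s)"
proof -
  note F = finite_energy_curveD[OF fin]
  define \<psi> where "\<psi> r = L2_inner \<Omega> f (z r)" for r
  define \<Psi> where "\<Psi> r = integral {s..r} \<psi>" for r
  have \<psi>der: "(\<psi> has_real_derivative L2_inner \<Omega> f (z' r)) (at r within {0..})" if "0 \<le> r" for r
    unfolding \<psi>_def by (rule has_real_derivative_L2_inner_const[OF fin f that])
  then have \<psi>cont: "continuous_on {0..} \<psi>"
    by (intro DERIV_continuous_on) auto
  have \<Psi>der: "(\<Psi> has_real_derivative \<psi> r) (at r within {s..Y})" if "s \<le> r" "r \<le> Y" for r Y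
    unfolding \<Psi>_def
    using that st by (intro integral_has_real_derivative continuous_on_subset[OF \<psi>cont]) auto
  define G where "G h r = L2_inner \<Omega> (z' r) (z (r + h)) - L2_inner \<Omega> (z' (r + h)) (z r)" for h r
  have G: "G h t - G h s = (\<Psi> (t + h) - \<Psi> t) - (\<Psi> (s + h) - \<Psi> s)" if h: "0 < h" "t + h < X" for h
  proof -
    \<comment> \<open>\<open>\<Psi>\<close> is an antiderivative of \<open>\<psi>\<close>, so this difference has zero derivative\<close>
    define D where "D r = G h r - (\<Psi> (r + h) - \<Psi> r)" for r
    have "(D has_real_derivative 0) (at r within {s..t})" if r: "r \<in> {s..t}" for r
    proof -
      have 1: "((\<lambda>q. L2_inner \<Omega> (z' (q + 0)) (z (q + h))) has_real_derivative
           L2_inner \<Omega> f (z (r + h)) - L2_inner \<Omega> (weak_gradient \<Omega> (z (r + 0))) (weak_gradient \<Omega> (z (r + h)))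
           + L2_inner \<Omega> (z' (r + 0)) (z' (r + h))) (at r within {s..t})"
        by (rule weak_wave_product_rule[OF fin wave]) (use r st h I in auto)
      have 2: "((\<lambda>q. L2_inner \<Omega> (z' (q + h)) (z (q + 0))) has_real_derivative
           L2_inner \<Omega> f (z (r + 0)) - L2_inner \<Omega> (weak_gradient \<Omega> (z (r + h))) (weak_gradient \<Omega> (z (r + 0)))
           + L2_inner \<Omega> (z' (r + h)) (z' (r + 0))) (at r within {s..t})"
        by (rule weak_wave_product_rule[OF fin wave]) (use r st h I in auto)
      have 3: "(\<Psi> has_real_derivative \<psi> r) (at r within {s..t})"
        using r by (intro \<Psi>der) auto
      have "(\<Psi> has_real_derivative \<psi> (r + h)) (at (r + h) within {s..t + h})"
        using r h by (intro \<Psi>der) auto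
      then have "(\<Psi> has_real_derivative \<psi> (r + h)) (at (r + h) within (\<lambda>q. q + h) ` {s..t})"
        using h by (auto intro: DERIV_subset)
      moreover have "((\<lambda>q. q + h) has_real_derivative 1) (at r within {s..t})"
        by (auto intro!: derivative_eq_intros)
      ultimately have 4: "((\<lambda>q. \<Psi> (q + h)) has_real_derivative \<psi> (r + h)) (at r within {s..t})"
        using DERIV_image_chain[of \<Psi> "\<psi> (r + h)" "\<lambda>q. q + h" r "{s..t}" 1] by (simp only: o_def mult_1_right)
      show ?thesis
        unfolding D_def G_def
        using DERIV_diff[OF DERIV_diff[OF 1 2] DERIV_diff[OF 4 3]]
        by (simp add: \<psi>_def L2_inner_commute[of \<Omega> "weak_gradient \<Omega> (z (r + h))"] L2_inner_commute[of \<Omega> "z' (r + h)" "z' r"])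
    qed
    then obtain c where "\<And>r. r \<in> {s..t} \<Longrightarrow> D r = c"
      using has_field_derivative_zero_constant[of "{s..t}" D] by auto
    then have "D t = D s"
      using st by simp
    then show ?thesis
      by (simp add: D_def)
  qed
  have Glim: "((\<lambda>h. G h r / h) \<longlongrightarrow> 2 * energy \<Omega> z z' r - \<psi> r) (at_right 0)" if r: "s \<le> r" "r < X" for r
  proof -
    define Y where "Y = (r + X) / 2"
    have Y: "r < Y" "Y < X" using r by (auto simp: Y_def)
    have "((\<lambda>q. L2_inner \<Omega> (z' r) (z q)) has_real_derivative L2_inner \<Omega> (z' r) (z' r)) (at r within {r..Y})"
      using r st F(4)[of r]
      by (intro DERIV_subset[OF has_real_derivative_L2_inner_const[OF fin]]) auto
    moreover have "z r \<in> H10_space \<Omega>" using F(1) r st by simp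
    with wave I r have "((\<lambda>q. L2_inner \<Omega> (z' q) (z r)) has_real_derivative
        \<psi> r - L2_inner \<Omega> (weak_gradient \<Omega> (z r)) (weak_gradient \<Omega> (z r))) (at r within I)"
      unfolding weak_wave_solution_on_def \<psi>_def by blast
    then have "((\<lambda>q. L2_inner \<Omega> (z' q) (z r)) has_real_derivative
        \<psi> r - L2_inner \<Omega> (weak_gradient \<Omega> (z r)) (weak_gradient \<Omega> (z r))) (at r within {r..Y})"
      by (rule DERIV_subset) (use r Y I in auto)
    ultimately have "((\<lambda>q. L2_inner \<Omega> (z' r) (z q) - L2_inner \<Omega> (z' q) (z r)) has_real_derivative
        2 * energy \<Omega> z z' r - \<psi> r) (at r within {r..Y})"
      by (auto intro!: derivative_eq_intros simp: energy_def L2_norm_power2)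
    then have "((\<lambda>q. (L2_inner \<Omega> (z' r) (z q) - L2_inner \<Omega> (z' q) (z r)) / (q - r)) \<longlongrightarrow>
        2 * energy \<Omega> z z' r - \<psi> r) (at_right r)"
      using Y by (simp add: has_field_derivative_iff at_within_Icc_at_right)
    then show ?thesis
      by (simp add: at_right_to_0[of r] filterlim_filtermap G_def add.commute)
  qed
  have \<Psi>lim: "((\<lambda>h. (\<Psi> (r + h) - \<Psi> r) / h) \<longlongrightarrow> \<psi> r) (at_right 0)" if r: "s \<le> r" for r
  proof -
    have "(\<Psi> has_real_derivative \<psi> r) (at r within {r..r + 1})"
      using r by (intro DERIV_subset[OF \<Psi>der[of r "r + 1"]]) auto
    then have "((\<lambda>q. (\<Psi> q - \<Psi> r) / (q - r)) \<longlongrightarrow> \<psi> r) (at_right r)"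
      by (simp add: has_field_derivative_iff at_within_Icc_at_right)
    then show ?thesis
      by (simp add: at_right_to_0[of r] filterlim_filtermap add.commute)
  qed
  have "((\<lambda>h. G h t / h - G h s / h) \<longlongrightarrow> (2 * energy \<Omega> z z' t - \<psi> t) - (2 * energy \<Omega> z z' s - \<psi> s)) (at_right 0)"
    using st by (intro tendsto_diff Glim) auto
  moreover have "((\<lambda>h. G h t / h - G h s / h) \<longlongrightarrow> \<psi> t - \<psi> s) (at_right 0)"
  proof (rule Lim_transform_eventually)
    show "((\<lambda>h. (\<Psi> (t + h) - \<Psi> t) / h - (\<Psi> (s + h) - \<Psi> s) / h) \<longlongrightarrow> \<psi> t - \<psi> s) (at_right 0)"
      using st by (intro tendsto_diff \<Psi>lim) auto
    show "\<forall>\<^sub>F h in at_right 0. (\<Psi> (t + h) - \<Psi> t) / h - (\<Psi> (s + h) - \<Psi> s) / h = G h t / h - G h s / h"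
      using st G by (auto simp: eventually_at_right_field diff_divide_distrib[symmetric] intro!: exI[of _ "X - t"])
  qed
  ultimately have "(2 * energy \<Omega> z z' t - \<psi> t) - (2 * energy \<Omega> z z' s - \<psi> s) = \<psi> t - \<psi> s"
    by (intro tendsto_unique[of "at_right 0"]) auto
  then show ?thesis
    by (simp add: \<psi>_def)
qed

lemma continuous_on_energy:
  assumes "finite_energy_curve \<Omega> z z'" "open \<Omega>" "bounded \<Omega>"
  shows "continuous_on {0..} (energy \<Omega> z z')"
  unfolding energy_def[abs_def]
  by (intro continuous_intros finite_energy_curve_continuous_norms[OF assms])

text \<open>At the right end point the equation may already have a new source; the identity persists there by
  continuity.\<close>

lemma energy_identity_closed:
  assumes dom: "open \<Omega>" "bounded \<Omega>"
    and fin: "finite_energy_curve \<Omega> z z'" and f: "f \<in> L2_space \<Omega>"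
    and wave: "weak_wave_solution_on \<Omega> I f z z'"
    and I: "{s..<X} \<subseteq> I" and st: "0 \<le> s" "s \<le> t" "t \<le> X"
  shows "energy \<Omega> z z' t - energy \<Omega> z z' s = L2_inner \<Omega> f (z t) - L2_inner \<Omega> f (z s)"
proof -
  define D where "D r = energy \<Omega> z z' r - L2_inner \<Omega> f (z r)" for r
  have D: "D r = D s" if "s \<le> r" "r < X" for r
  proof -
    have "energy \<Omega> z z' r - energy \<Omega> z z' s = L2_inner \<Omega> f (z r) - L2_inner \<Omega> f (z s)"
      by (rule energy_identity[OF fin f wave]) (use I st(1) that in auto)
    then show ?thesis
      by (simp add: D_def)
  qed
  have "D t = D s"
  proof (cases "t = X \<and> s < X")
    case False
    then show ?thesis
      using D[of t] st by (cases "t = s") auto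
  next
    case True
    have "continuous_on {0..} (\<lambda>r. L2_inner \<Omega> f (z r))"
      using has_real_derivative_L2_inner_const[OF fin f]
      by (intro DERIV_continuous_on) auto
    then have "continuous_on {0..} D"
      unfolding D_def by (intro continuous_on_diff continuous_on_energy[OF fin dom])
    then have cont: "continuous_on {s..X} D"
      by (rule continuous_on_subset) (use st(1) in auto)
    have cl: "closure {s..<X} = {s..X}"
      using True by simp
    have "D X = D s"
    proof (rule continuous_constant_on_closure[of "{s..<X}", unfolded cl, OF cont])
      show "D r = D s" if "r \<in> {s..<X}" for r
        using D[of r] that by simp
    qed (use True in auto)
    then show ?thesis
      using True by simp
  qed
  then show ?thesis
    by (simp add: D_def)
qed

section \<open>The Lyapunov functional\<close>

text \<open>
  The cross term \<open>\<langle>z', z\<rangle>\<close> recovers the dissipation of \<open>\<parallel>\<nabla>z\<parallel>\<^sup>2\<close> that the energy alone does not see; the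
  multiple of \<open>\<parallel>z\<parallel>\<^sup>2\<close> cancels the term \<open>- \<alpha> \<langle>z', z\<rangle>\<close> that the damping contributes to its derivative.
\<close>

definition lyapunov ::
    "'a::euclidean_space set \<Rightarrow> real \<Rightarrow> real \<Rightarrow> (real \<Rightarrow> 'a \<Rightarrow> real) \<Rightarrow> (real \<Rightarrow> 'a \<Rightarrow> real) \<Rightarrow> real \<Rightarrow> real" where
  "lyapunov \<Omega> \<alpha> \<epsilon> z z' t =
     energy \<Omega> z z' t + \<epsilon> * (L2_inner \<Omega> (z' t) (z t) + \<alpha> / 2 * (L2_norm \<Omega> (z t))\<^sup>2)"

text \<open>Young's inequality and the Poincare inequality bound the added terms by a fraction of the energy.\<close>

lemma lyapunov_energy_bounds:
  assumes fin: "finite_energy_curve \<Omega> z z'" and t: "0 \<le> t"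
    and P: "(L2_norm \<Omega> (z t))\<^sup>2 \<le> 2 * (L2_norm \<Omega> (weak_gradient \<Omega> (z t)))\<^sup>2"
    and \<epsilon>: "0 < \<epsilon>" "\<epsilon> \<le> 1 / 4" "\<epsilon> * \<alpha> \<le> 1 / 4" and "0 < \<alpha>"
  shows "energy \<Omega> z z' t \<le> 2 * lyapunov \<Omega> \<alpha> \<epsilon> z z' t"
    and "lyapunov \<Omega> \<alpha> \<epsilon> z z' t \<le> 2 * energy \<Omega> z z' t"
proof -
  define n m g p where "n = L2_norm \<Omega> (z' t)" and "m = L2_norm \<Omega> (z t)"
    and "g = L2_norm \<Omega> (weak_gradient \<Omega> (z t))" and "p = L2_inner \<Omega> (z' t) (z t)"
  have p: "\<bar>p\<bar> \<le> n * m"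
    unfolding p_def n_def m_def using finite_energy_curveD[OF fin t] by (intro L2_inner_Cauchy_Schwarz)
  have m: "m\<^sup>2 \<le> 2 * g\<^sup>2"
    using P by (simp add: m_def g_def)
  have "2 * (n * m) \<le> n\<^sup>2 + m\<^sup>2"
    using sum_squares_bound[of n m] by simp
  then have "\<bar>p\<bar> \<le> n\<^sup>2 / 2 + g\<^sup>2"
    using p m by linarith
  then have "\<epsilon> * \<bar>p\<bar> \<le> 1 / 4 * (n\<^sup>2 / 2 + g\<^sup>2)"
    using \<epsilon> by (intro mult_mono) auto
  then have "\<bar>\<epsilon> * p\<bar> \<le> n\<^sup>2 / 8 + g\<^sup>2 / 4"
    using \<epsilon> by (simp add: abs_mult algebra_simps)
  then have 1: "\<epsilon> * p \<le> n\<^sup>2 / 8 + g\<^sup>2 / 4" "- (\<epsilon> * p) \<le> n\<^sup>2 / 8 + g\<^sup>2 / 4"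
    by (auto simp: abs_le_iff)
  have 2: "\<epsilon> * \<alpha> * m\<^sup>2 \<le> 1 / 4 * (2 * g\<^sup>2)"
    using \<epsilon> m \<open>0 < \<alpha>\<close> by (intro mult_mono) auto
  have 3: "0 \<le> \<epsilon> * \<alpha> * m\<^sup>2"
    using \<epsilon> \<open>0 < \<alpha>\<close> by simp
  have E: "energy \<Omega> z z' t = (n\<^sup>2 + g\<^sup>2) / 2"
    by (simp add: energy_def n_def g_def)
  have V: "lyapunov \<Omega> \<alpha> \<epsilon> z z' t = energy \<Omega> z z' t + \<epsilon> * p + \<epsilon> * \<alpha> * m\<^sup>2 / 2"
    by (simp add: lyapunov_def p_def m_def algebra_simps)
  have 4: "0 \<le> n\<^sup>2" "0 \<le> g\<^sup>2" by simp_all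
  define x y N G where "x = \<epsilon> * p" and "y = \<epsilon> * \<alpha> * m\<^sup>2" and "N = n\<^sup>2" and "G = g\<^sup>2"
  note abb = x_def[symmetric] y_def[symmetric] N_def[symmetric] G_def[symmetric]
  show "energy \<Omega> z z' t \<le> 2 * lyapunov \<Omega> \<alpha> \<epsilon> z z' t"
    using 1 2 3 4 unfolding V E abb by (simp add: field_simps)
  show "lyapunov \<Omega> \<alpha> \<epsilon> z z' t \<le> 2 * energy \<Omega> z z' t"
    using 1 2 3 4 unfolding V E abb by (simp add: field_simps)
qed

lemma continuous_on_lyapunov:
  assumes fin: "finite_energy_curve \<Omega> z z'" and dom: "open \<Omega>" "bounded \<Omega>"
  shows "continuous_on {0..} (lyapunov \<Omega> \<alpha> \<epsilon> z z')"
proof -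
  have "continuous_on {0..} (\<lambda>t. L2_inner \<Omega> (z' t) (z t))"
    unfolding continuous_on_def
    using finite_energy_curveD[OF fin] finite_energy_curve_tendsto_L2[OF fin]
    by (intro ballI tendsto_L2_inner) auto
  then show ?thesis
    unfolding lyapunov_def[abs_def]
    by (intro continuous_intros continuous_on_energy[OF assms] finite_energy_curve_continuous_norms[OF assms])
qed

lemma lyapunov_has_real_derivative:
  assumes dom: "open \<Omega>" "bounded \<Omega>"
    and fin: "finite_energy_curve \<Omega> z z'" and f: "f \<in> L2_space \<Omega>"
    and wave: "weak_wave_solution_on \<Omega> I f z z'"
    and I: "{s..<X} \<subseteq> I" and st: "0 \<le> s" "s < t" "t < X"
  shows "(lyapunov \<Omega> \<alpha> \<epsilon> z z' has_real_derivative
            L2_inner \<Omega> f (z' t) + \<epsilon> * (L2_inner \<Omega> f (z t) - (L2_norm \<Omega> (weak_gradient \<Omega> (z t)))\<^sup>2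
              + (L2_norm \<Omega> (z' t))\<^sup>2 + \<alpha> * L2_inner \<Omega> (z' t) (z t))) (at t)"
proof -
  note F = finite_energy_curveD[OF fin]
  have at: "at t within {s<..<X} = at t"
    using st by (intro at_within_open) auto
  have z: "((\<lambda>r. L2_inner \<Omega> h (z r)) has_real_derivative L2_inner \<Omega> h (z' t)) (at t within {s<..<X})"
    if "h \<in> L2_space \<Omega>" for h
    using has_real_derivative_L2_inner_const[OF fin that, of t] st by (auto elim: DERIV_subset)
  have "((\<lambda>r. energy \<Omega> z z' s - L2_inner \<Omega> f (z s) + L2_inner \<Omega> f (z r)) has_real_derivative
      L2_inner \<Omega> f (z' t)) (at t within {s<..<X})"
    using z[OF f] by (auto intro!: derivative_eq_intros)
  then have E: "(energy \<Omega> z z' has_real_derivative L2_inner \<Omega> f (z' t)) (at t within {s<..<X})"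
  proof (rule has_field_derivative_transform_within)
    show "(0::real) < 1" "t \<in> {s<..<X}" using st by simp_all
    fix r assume "r \<in> {s<..<X}"
    then show "energy \<Omega> z z' s - L2_inner \<Omega> f (z s) + L2_inner \<Omega> f (z r) = energy \<Omega> z z' r"
      using energy_identity_closed[OF dom fin f wave I, of r] st by simp
  qed
  have P: "((\<lambda>r. L2_inner \<Omega> (z' (r + 0)) (z (r + 0))) has_real_derivative
      L2_inner \<Omega> f (z (t + 0)) - L2_inner \<Omega> (weak_gradient \<Omega> (z (t + 0))) (weak_gradient \<Omega> (z (t + 0)))
      + L2_inner \<Omega> (z' (t + 0)) (z' (t + 0))) (at t within {s<..<X})"
    by (rule weak_wave_product_rule[OF fin wave]) (use st I in auto)
  have N: "((\<lambda>r. L2_inner \<Omega> (z r) (z r)) has_real_derivative 2 * L2_inner \<Omega> (z' t) (z t)) (at t within {s<..<X})"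
  proof -
    have zt: "((\<lambda>r. L2_inner \<Omega> (z t) (z r)) has_real_derivative L2_inner \<Omega> (z t) (z' t)) (at t within {s<..<X})"
      using z F(3) st by simp
    have sub: "at t within {s<..<X} \<le> at t within {0..}"
      using st by (intro at_le) auto
    have "((\<lambda>r. L2_inner \<Omega> (z r) (\<lambda>x. (z r x - z t x) / (r - t))) \<longlongrightarrow> L2_inner \<Omega> (z t) (z' t)) (at t within {s<..<X})"
    proof (rule tendsto_mono[OF sub])
      show "((\<lambda>r. L2_inner \<Omega> (z r) (\<lambda>x. (z r x - z t x) / (r - t))) \<longlongrightarrow> L2_inner \<Omega> (z t) (z' t)) (at t within {0..})"
        using st F(3,4) F(7)[of t] finite_energy_curve_tendsto_L2[OF fin, of t]
        by (intro tendsto_L2_inner L2_space_divide L2_space_diff) auto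
    qed
    from tendsto_add[OF this zt[unfolded has_field_derivative_iff]]
    have lim: "((\<lambda>r. L2_inner \<Omega> (z r) (\<lambda>x. (z r x - z t x) / (r - t)) + (L2_inner \<Omega> (z t) (z r) - L2_inner \<Omega> (z t) (z t)) / (r - t))
        \<longlongrightarrow> 2 * L2_inner \<Omega> (z' t) (z t)) (at t within {s<..<X})"
      by (simp add: L2_inner_commute)
    show ?thesis
      unfolding has_field_derivative_iff
    proof (rule Lim_transform_eventually[OF lim])
      have "L2_inner \<Omega> (z r) (\<lambda>x. (z r x - z t x) / (r - t)) + (L2_inner \<Omega> (z t) (z r) - L2_inner \<Omega> (z t) (z t)) / (r - t)
          = (L2_inner \<Omega> (z r) (z r) - L2_inner \<Omega> (z t) (z t)) / (r - t)" if "r \<in> {s<..<X}" for r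
      proof -
        have "L2_inner \<Omega> (z r) (\<lambda>x. (z r x - z t x) / (r - t))
            = (L2_inner \<Omega> (z r) (z r) - L2_inner \<Omega> (z t) (z r)) / (r - t)"
          using st that F(3)
          by (simp add: L2_inner_divide_right L2_inner_diff_right L2_inner_commute[of \<Omega> "z t" "z r"])
        then show ?thesis
          by (simp add: add_divide_distrib[symmetric])
      qed
      then show "\<forall>\<^sub>F r in at t within {s<..<X}. L2_inner \<Omega> (z r) (\<lambda>x. (z r x - z t x) / (r - t)) + (L2_inner \<Omega> (z t) (z r) - L2_inner \<Omega> (z t) (z t)) / (r - t)
          = (L2_inner \<Omega> (z r) (z r) - L2_inner \<Omega> (z t) (z t)) / (r - t)"
        by (simp add: eventually_at_filter)
    qed
  qed
  show ?thesis
    unfolding lyapunov_def[abs_def] L2_norm_power2 at[symmetric]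
    by (rule DERIV_cong[OF DERIV_add[OF E DERIV_cmult[OF DERIV_add[OF P[simplified] DERIV_cmult[OF N]]]]])
      (simp add: algebra_simps L2_norm_power2)
qed

text \<open>
  The left-hand side is the derivative of the Lyapunov functional with \<open>n = \<parallel>z'\<parallel>\<close>, \<open>m = \<parallel>z\<parallel>\<close>, \<open>g = \<parallel>\<nabla>z\<parallel>\<close>,
  \<open>q = \<parallel>e\<parallel>\<close>, \<open>p1 = \<langle>e, z'\<rangle>\<close> and \<open>p2 = \<langle>e, z\<rangle>\<close>. Young's inequality bounds the error terms by
  \<open>\<alpha> q\<^sup>2 + \<alpha> n\<^sup>2/2 + \<epsilon> g\<^sup>2/4\<close>. The triggering constants are such that \<open>\<alpha> q\<^sup>2\<close> costs at most \<open>\<alpha> n\<^sup>2/8\<close> and \<open>\<epsilon> g\<^sup>2/4\<close>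
  besides \<open>\<alpha> \<eta>\<close>, which leaves half of \<open>- \<epsilon> g\<^sup>2\<close> and enough of \<open>- \<alpha> n\<^sup>2\<close> to pay for \<open>\<epsilon> n\<^sup>2\<close>.
\<close>

lemma damping_dominates:
  fixes n m g q :: real
  assumes \<alpha>: "0 < \<alpha>" and \<epsilon>: "0 < \<epsilon>" "\<epsilon> \<le> \<alpha> / 8" "\<epsilon> * \<alpha> \<le> 1 / 4"
    and m: "m\<^sup>2 \<le> 2 * g\<^sup>2" and q: "q\<^sup>2 \<le> \<epsilon> / (8 * \<alpha>) * m\<^sup>2 + 1 / 8 * n\<^sup>2 + \<eta>"
    and p: "p1 \<le> q * n" "p2 \<le> q * m"
  shows "- \<alpha> * n\<^sup>2 + \<alpha> * p1 + \<epsilon> * (\<alpha> * p2 - g\<^sup>2 + n\<^sup>2) \<le> - \<epsilon> * ((n\<^sup>2 + g\<^sup>2) / 2) + \<alpha> * \<eta>"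
proof -
  have "p1 \<le> (q\<^sup>2 + n\<^sup>2) / 2"
    using p sum_squares_bound[of q n] by simp
  then have 1: "\<alpha> * p1 \<le> \<alpha> * ((q\<^sup>2 + n\<^sup>2) / 2)"
    using \<alpha> by (intro mult_left_mono) auto
  have "\<epsilon> * p2 \<le> \<epsilon> * (q * m)"
    using p \<epsilon> by (intro mult_left_mono) auto
  also have "\<dots> \<le> (q\<^sup>2 + \<epsilon>\<^sup>2 * m\<^sup>2) / 2"
    using sum_squares_bound[of q "\<epsilon> * m"] by (simp add: power_mult_distrib algebra_simps)
  finally have p2: "\<alpha> * (\<epsilon> * p2) \<le> \<alpha> * ((q\<^sup>2 + \<epsilon>\<^sup>2 * m\<^sup>2) / 2)"
    using \<alpha> by (intro mult_left_mono) auto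
  have \<epsilon>m: "\<epsilon> * m\<^sup>2 \<le> \<epsilon> * (2 * g\<^sup>2)"
    using m \<epsilon> by (intro mult_left_mono) auto
  have \<epsilon>\<epsilon>m: "\<epsilon> * \<alpha> * (\<epsilon> * m\<^sup>2) \<le> 1 / 4 * (\<epsilon> * m\<^sup>2)"
    using \<epsilon> by (intro mult_right_mono) auto
  have "\<alpha> * ((q\<^sup>2 + \<epsilon>\<^sup>2 * m\<^sup>2) / 2) = \<alpha> * q\<^sup>2 / 2 + \<epsilon> * \<alpha> * (\<epsilon> * m\<^sup>2) / 2"
    by (simp add: power2_eq_square algebra_simps)
  then have 2: "\<alpha> * (\<epsilon> * p2) \<le> \<alpha> * q\<^sup>2 / 2 + \<epsilon> * g\<^sup>2 / 4"
    using p2 \<epsilon>m \<epsilon>\<epsilon>m by linarith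
  have "\<alpha> * q\<^sup>2 \<le> \<alpha> * (\<epsilon> / (8 * \<alpha>) * m\<^sup>2 + 1 / 8 * n\<^sup>2 + \<eta>)"
    using q \<alpha> by (intro mult_left_mono) auto
  also have "\<dots> = \<epsilon> * m\<^sup>2 / 8 + \<alpha> * n\<^sup>2 / 8 + \<alpha> * \<eta>"
    using \<alpha> by (simp add: field_simps)
  finally have 3: "\<alpha> * q\<^sup>2 \<le> \<epsilon> * g\<^sup>2 / 4 + \<alpha> * n\<^sup>2 / 8 + \<alpha> * \<eta>"
    using \<epsilon>m by linarith
  have 4: "\<epsilon> * n\<^sup>2 \<le> \<alpha> / 8 * n\<^sup>2"
    using \<epsilon> by (intro mult_right_mono) auto
  define A P1 P2 Q G N H where "A = \<alpha> * n\<^sup>2" and "P1 = \<alpha> * p1" and "P2 = \<alpha> * (\<epsilon> * p2)"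
    and "Q = \<alpha> * q\<^sup>2" and "G = \<epsilon> * g\<^sup>2" and "N = \<epsilon> * n\<^sup>2" and "H = \<alpha> * \<eta>"
  have "P1 \<le> Q / 2 + A / 2" "P2 \<le> Q / 2 + G / 4" "Q \<le> G / 4 + A / 8 + H" "N \<le> A / 8"
    using 1 2 3 4 by (simp_all add: A_def P1_def P2_def Q_def G_def N_def H_def field_simps)
  moreover have "0 \<le> N"
    using \<epsilon> by (simp add: N_def)
  ultimately have "- A + P1 + P2 - G + N \<le> - N / 2 - G / 2 + H"
    by linarith
  then show ?thesis
    by (simp add: A_def P1_def P2_def Q_def G_def N_def H_def field_simps)
qed

text \<open>The second summand of \<open>W\<close> is the tail integral over \<open>(t, \<infinity>)\<close> of the inhomogeneity
  \<open>\<alpha> exp (\<epsilon> s/2) exp (- s)\<close>, so adding it turns the differential inequality for the functional into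
  monotonicity.\<close>

lemma weighted_lyapunov_decreases_between_samples:
  assumes dom: "open \<Omega>" "bounded \<Omega>"
    and fin: "finite_energy_curve \<Omega> z z'" and a: "0 \<le> a" "a \<le> X"
    and wave: "weak_wave_solution_on \<Omega> I (\<lambda>x. - \<alpha> * z' a x) z z'" and I: "{a..<X} \<subseteq> I"
    and P: "\<And>t. 0 \<le> t \<Longrightarrow> (L2_norm \<Omega> (z t))\<^sup>2 \<le> 2 * (L2_norm \<Omega> (weak_gradient \<Omega> (z t)))\<^sup>2"
    and \<alpha>: "0 < \<alpha>" and \<epsilon>: "0 < \<epsilon>" "\<epsilon> \<le> \<alpha> / 8" "\<epsilon> * \<alpha> \<le> 1 / 4" "\<epsilon> \<le> 1 / 4"
    and no_event: "\<And>t. a \<le> t \<Longrightarrow> t < X \<Longrightarrow> (L2_norm \<Omega> (\<lambda>x. z' t x - z' a x))\<^sup>2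
        \<le> \<epsilon> / (8 * \<alpha>) * (L2_norm \<Omega> (z t))\<^sup>2 + 1 / 8 * (L2_norm \<Omega> (z' t))\<^sup>2 + exp (- t)"
  defines "W \<equiv> \<lambda>t. exp (\<epsilon> / 2 * t) * lyapunov \<Omega> \<alpha> \<epsilon> z z' t + \<alpha> / (1 - \<epsilon> / 2) * exp (- (1 - \<epsilon> / 2) * t)"
  shows "W X \<le> W a"
proof (rule DERIV_nonpos_imp_decreasing_open[OF a(2)])
    show "continuous_on {a..X} W"
      unfolding W_def using a
      by (intro continuous_intros continuous_on_subset[OF continuous_on_lyapunov[OF fin dom]]) auto
    fix t assume t: "a < t" "t < X"
    define f where "f = (\<lambda>x. - \<alpha> * z' a x)"
    define e where "e = (\<lambda>x. z' t x - z' a x)"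
    note F = finite_energy_curveD[OF fin]
    have t0: "0 \<le> t" using t a by simp
    have f: "f \<in> L2_space \<Omega>" and e: "e \<in> L2_space \<Omega>"
      unfolding f_def e_def using F(4) a t by (auto intro!: L2_space_cmult[of _ _ "- \<alpha>", simplified] L2_space_diff)
    have fe: "L2_inner \<Omega> f h = - \<alpha> * L2_inner \<Omega> (z' t) h + \<alpha> * L2_inner \<Omega> e h" if "h \<in> L2_space \<Omega>" for h
      unfolding f_def e_def using F(4)[OF t0] F(4)[OF a(1)] that
      by (simp only: L2_inner_cmult_left) (simp add: L2_inner_diff_left algebra_simps)
    define dV where "dV = L2_inner \<Omega> f (z' t) + \<epsilon> * (L2_inner \<Omega> f (z t) - (L2_norm \<Omega> (weak_gradient \<Omega> (z t)))\<^sup>2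
              + (L2_norm \<Omega> (z' t))\<^sup>2 + \<alpha> * L2_inner \<Omega> (z' t) (z t))"
    have dV: "(lyapunov \<Omega> \<alpha> \<epsilon> z z' has_real_derivative dV) (at t)"
      unfolding dV_def using wave t a by (intro lyapunov_has_real_derivative[OF dom fin f _ I]) (auto simp: f_def)
    have "dV = - \<alpha> * (L2_norm \<Omega> (z' t))\<^sup>2 + \<alpha> * L2_inner \<Omega> e (z' t)
        + \<epsilon> * (\<alpha> * L2_inner \<Omega> e (z t) - (L2_norm \<Omega> (weak_gradient \<Omega> (z t)))\<^sup>2 + (L2_norm \<Omega> (z' t))\<^sup>2)"
      unfolding dV_def by (simp add: fe F(3,4) t0 L2_norm_power2 algebra_simps)
    also have "\<dots> \<le> - \<epsilon> * (((L2_norm \<Omega> (z' t))\<^sup>2 + (L2_norm \<Omega> (weak_gradient \<Omega> (z t)))\<^sup>2) / 2) + \<alpha> * exp (- t)"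
    proof (rule damping_dominates[OF \<alpha> \<epsilon>(1-3) P[OF t0]])
      show "(L2_norm \<Omega> e)\<^sup>2 \<le> \<epsilon> / (8 * \<alpha>) * (L2_norm \<Omega> (z t))\<^sup>2 + 1 / 8 * (L2_norm \<Omega> (z' t))\<^sup>2 + exp (- t)"
        unfolding e_def using no_event t by simp
      show "L2_inner \<Omega> e (z' t) \<le> L2_norm \<Omega> e * L2_norm \<Omega> (z' t)"
           "L2_inner \<Omega> e (z t) \<le> L2_norm \<Omega> e * L2_norm \<Omega> (z t)"
        using L2_inner_Cauchy_Schwarz[OF e F(4)[OF t0]] L2_inner_Cauchy_Schwarz[OF e F(3)[OF t0]] by auto
    qed
    also have "\<dots> = - \<epsilon> * energy \<Omega> z z' t + \<alpha> * exp (- t)"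
      by (simp add: energy_def)
    also have "\<dots> \<le> - (\<epsilon> / 2) * lyapunov \<Omega> \<alpha> \<epsilon> z z' t + \<alpha> * exp (- t)"
    proof -
      have "\<epsilon> * lyapunov \<Omega> \<alpha> \<epsilon> z z' t \<le> \<epsilon> * (2 * energy \<Omega> z z' t)"
        using lyapunov_energy_bounds(2)[OF fin t0 P[OF t0] \<epsilon>(1,4,3) \<alpha>] \<epsilon> by (intro mult_left_mono) auto
      then show ?thesis by simp
    qed
    finally have "exp (\<epsilon> / 2 * t) * (dV + \<epsilon> / 2 * lyapunov \<Omega> \<alpha> \<epsilon> z z' t) \<le> exp (\<epsilon> / 2 * t) * (\<alpha> * exp (- t))"
      by (intro mult_left_mono) auto
    also have "\<dots> = \<alpha> * exp (- (1 - \<epsilon> / 2) * t)"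
      by (simp add: exp_add[symmetric] algebra_simps)
    finally have neg: "exp (\<epsilon> / 2 * t) * (dV + \<epsilon> / 2 * lyapunov \<Omega> \<alpha> \<epsilon> z z' t) - \<alpha> * exp (- (1 - \<epsilon> / 2) * t) \<le> 0"
      by simp
    define \<kappa> where "\<kappa> = 1 - \<epsilon> / 2"
    have "\<kappa> \<noteq> 0" using \<epsilon> by (simp add: \<kappa>_def)
    then have "((\<lambda>t. \<alpha> / \<kappa> * exp (- \<kappa> * t)) has_real_derivative - \<alpha> * exp (- \<kappa> * t)) (at t)"
      by (auto intro!: derivative_eq_intros)
    moreover have "((\<lambda>t. exp (\<epsilon> / 2 * t) * lyapunov \<Omega> \<alpha> \<epsilon> z z' t) has_real_derivative
        exp (\<epsilon> / 2 * t) * (dV + \<epsilon> / 2 * lyapunov \<Omega> \<alpha> \<epsilon> z z' t)) (at t)"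
      using dV by (auto intro!: derivative_eq_intros simp: algebra_simps)
    ultimately have "(W has_real_derivative exp (\<epsilon> / 2 * t) * (dV + \<epsilon> / 2 * lyapunov \<Omega> \<alpha> \<epsilon> z z' t)
        + - \<alpha> * exp (- \<kappa> * t)) (at t)"
      unfolding W_def \<kappa>_def by (intro DERIV_add)
    then show "\<exists>y. (W has_real_derivative y) (at t) \<and> y \<le> 0"
      using neg by (auto simp: \<kappa>_def)
qed

section \<open>The sampling times\<close>

lemma event_times_mono:
  assumes "event_times \<Omega> \<gamma>\<^sub>0 \<gamma>\<^sub>1 \<eta> z z' \<tau>"
  shows "mono \<tau>"
  unfolding mono_iff_le_Suc
proof
  fix k
  show "\<tau> k \<le> \<tau> (Suc k)"
    using assms unfolding event_times_def by (auto intro!: Inf_greatest)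
qed

lemma no_event_before_next_sampling:
  assumes "event_times \<Omega> \<gamma>\<^sub>0 \<gamma>\<^sub>1 \<eta> z z' \<tau>" "\<tau> k = ereal a" "a \<le> t" "ereal t < \<tau> (Suc k)"
  shows "(L2_norm \<Omega> (\<lambda>x. z' t x - z' a x))\<^sup>2
           \<le> \<gamma>\<^sub>0 * (L2_norm \<Omega> (z t))\<^sup>2 + \<gamma>\<^sub>1 * (L2_norm \<Omega> (z' t))\<^sup>2 + \<eta> t"
proof (rule ccontr)
  assume neg: "\<not> ?thesis"
  have "\<tau> (Suc k) \<le> ereal t"
  proof -
    have "\<tau> (Suc k) = Inf {ereal s | s. \<tau> k \<le> ereal s \<and>
        (L2_norm \<Omega> (\<lambda>x. z' s x - z' (real_of_ereal (\<tau> k)) x))\<^sup>2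
          - \<gamma>\<^sub>0 * (L2_norm \<Omega> (z s))\<^sup>2 - \<gamma>\<^sub>1 * (L2_norm \<Omega> (z' s))\<^sup>2 - \<eta> s \<ge> 0}"
      using assms(1) unfolding event_times_def by blast
    also have "\<dots> \<le> ereal t"
      by (rule Inf_lower) (use neg assms(2,3) in auto)
    finally show ?thesis .
  qed
  then show False
    using assms(4) by simp
qed

text \<open>The triggering condition is closed in time, so it holds at the infimum; dropping the nonnegative
  state terms leaves this lower bound.\<close>

lemma velocity_jump_at_next_sampling:
  assumes ev: "event_times \<Omega> \<gamma>\<^sub>0 \<gamma>\<^sub>1 \<eta> z z' \<tau>" and fin: "finite_energy_curve \<Omega> z z'"
    and \<gamma>: "0 \<le> \<gamma>\<^sub>0" "0 \<le> \<gamma>\<^sub>1" and \<eta>: "continuous_on {0..} \<eta>"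
    and \<tau>: "\<tau> k = ereal a" "\<tau> (Suc k) = ereal b" and a: "0 \<le> a"
  shows "\<eta> b \<le> (L2_norm \<Omega> (\<lambda>x. z' b x - z' a x))\<^sup>2"
proof (rule ccontr)
  assume neg: "\<not> ?thesis"
  have b: "0 \<le> b"
    using monoD[OF event_times_mono[OF ev], of k "Suc k"] \<tau> a by simp
  define h where "h s = (L2_norm \<Omega> (\<lambda>x. z' s x - z' a x))\<^sup>2 - \<eta> s" for s
  note F = finite_energy_curveD[OF fin]
  have "continuous_on {0..} h"
    unfolding h_def using F(4,8) a
    by (intro continuous_intros \<eta> continuous_on_L2_norm L2_space_diff) auto
  then have "(h \<longlongrightarrow> h b) (at b within {0..})"
    using b by (simp add: continuous_on_def)
  moreover have "h b < 0"
    using neg by (simp add: h_def)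
  ultimately have "\<forall>\<^sub>F s in at b within {0..}. h s < 0"
    by (rule order_tendstoD(2))
  then obtain d where d: "d > 0" "\<And>s. 0 \<le> s \<Longrightarrow> s \<noteq> b \<Longrightarrow> \<bar>s - b\<bar> < d \<Longrightarrow> h s < 0"
    by (auto simp: eventually_at dist_real_def)
  have hneg: "h s < 0" if "b \<le> s" "s < b + d" for s
    using d(2)[of s] that b neg by (cases "s = b") (auto simp: h_def)
  define S where "S = {ereal s | s. \<tau> k \<le> ereal s \<and>
        (L2_norm \<Omega> (\<lambda>x. z' s x - z' (real_of_ereal (\<tau> k)) x))\<^sup>2
          - \<gamma>\<^sub>0 * (L2_norm \<Omega> (z s))\<^sup>2 - \<gamma>\<^sub>1 * (L2_norm \<Omega> (z' s))\<^sup>2 - \<eta> s \<ge> 0}"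
  have S: "Inf S = ereal b"
    using ev \<tau>(2) unfolding event_times_def S_def by metis
  then have "Inf S < ereal (b + d)"
    using d(1) by simp
  then obtain s where s: "ereal s \<in> S" "s < b + d"
    unfolding Inf_less_iff by (auto simp: S_def)
  have "b \<le> s"
    using Inf_lower[OF s(1)] S by simp
  moreover have "0 \<le> h s"
  proof -
    have "0 \<le> (L2_norm \<Omega> (\<lambda>x. z' s x - z' a x))\<^sup>2
          - \<gamma>\<^sub>0 * (L2_norm \<Omega> (z s))\<^sup>2 - \<gamma>\<^sub>1 * (L2_norm \<Omega> (z' s))\<^sup>2 - \<eta> s"
      using s(1) \<tau>(1) by (auto simp: S_def)
    moreover have "0 \<le> \<gamma>\<^sub>0 * (L2_norm \<Omega> (z s))\<^sup>2" "0 \<le> \<gamma>\<^sub>1 * (L2_norm \<Omega> (z' s))\<^sup>2"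
      using \<gamma> by simp_all
    ultimately show ?thesis
      unfolding h_def by linarith
  qed
  ultimately show False
    using hneg[of s] s(2) by simp
qed

text \<open>Otherwise the sampling times converge to some finite \<open>L\<close>; then consecutive velocities approach each other by
  continuity, while their squared distance stays above values of \<open>\<eta>\<close> that tend to \<open>\<eta> L > 0\<close>.\<close>

lemma sampling_times_unbounded:
  assumes ev: "event_times \<Omega> \<gamma>\<^sub>0 \<gamma>\<^sub>1 \<eta> z z' \<tau>" and fin: "finite_energy_curve \<Omega> z z'"
    and \<gamma>: "0 \<le> \<gamma>\<^sub>0" "0 \<le> \<gamma>\<^sub>1"
    and \<eta>: "continuous_on {0..} \<eta>" "\<And>t. 0 \<le> t \<Longrightarrow> 0 < \<eta> t"
  shows "\<exists>k. ereal T < \<tau> k"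
proof (rule ccontr)
  assume "\<not> ?thesis"
  then have T: "\<tau> k \<le> ereal T" for k
    by (simp add: not_less)
  have mono: "mono \<tau>"
    by (rule event_times_mono[OF ev])
  have "\<tau> 0 = 0"
    using ev by (simp add: event_times_def)
  then have nn: "0 \<le> \<tau> k" for k
    using monoD[OF mono, of 0 k] by simp
  define t where "t k = real_of_ereal (\<tau> k)" for k
  have t: "\<tau> k = ereal (t k)" for k
    using T[of k] nn[of k] by (cases "\<tau> k") (auto simp: t_def)
  have t0: "0 \<le> t k" for k
    using nn[of k] by (simp add: t)
  have "incseq t" "\<And>k. t k \<le> T"
    using mono T by (auto simp: mono_def t)
  then obtain L where L: "t \<longlonglongrightarrow> L" "\<And>k. t k \<le> L"
    using incseq_convergent[of t T] by auto
  have L0: "0 \<le> L"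
    using t0[of 0] L(2)[of 0] by simp
  note F = finite_energy_curveD[OF fin]
  define N where "N s = L2_norm \<Omega> (\<lambda>x. z' s x - z' L x)" for s
  have "continuous_on {0..} N"
    unfolding N_def using F(4,8) L0
    by (intro continuous_on_L2_norm L2_space_diff) auto
  then have "(\<lambda>k. N (t k)) \<longlonglongrightarrow> N L"
    by (rule continuous_on_tendsto_compose[OF _ L(1)]) (use t0 L0 in auto)
  moreover have "N L = 0"
    by (simp add: N_def L2_norm_def)
  ultimately have N: "(\<lambda>k. N (t k)) \<longlonglongrightarrow> 0"
    by simp
  have le: "\<eta> (t (Suc k)) \<le> (N (t (Suc k)) + N (t k))\<^sup>2" for k
  proof -
    have "\<eta> (t (Suc k)) \<le> (L2_norm \<Omega> (\<lambda>x. z' (t (Suc k)) x - z' (t k) x))\<^sup>2"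
      by (rule velocity_jump_at_next_sampling[OF ev fin \<gamma> \<eta>(1) t t t0])
    also have "\<dots> \<le> (N (t (Suc k)) + N (t k))\<^sup>2"
      unfolding N_def using F(4) t0 L0 L2_norm_minus_commute[of \<Omega> "z' (t k)" "z' L"]
      by (intro power_mono) (auto intro: L2_norm_triangle_diff)
    finally show ?thesis .
  qed
  have "(\<lambda>k. (N (t (Suc k)) + N (t k))\<^sup>2) \<longlonglongrightarrow> (0 + 0)\<^sup>2"
    by (intro tendsto_intros N LIMSEQ_Suc[OF N])
  moreover have "(\<lambda>k. \<eta> (t (Suc k))) \<longlonglongrightarrow> \<eta> L"
    by (rule continuous_on_tendsto_compose[OF \<eta>(1) LIMSEQ_Suc[OF L(1)]]) (use t0 L0 in auto)
  ultimately have "\<eta> L \<le> (0 + 0)\<^sup>2"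
    using le by (intro LIMSEQ_le[of "\<lambda>k. \<eta> (t (Suc k))" _ "\<lambda>k. (N (t (Suc k)) + N (t k))\<^sup>2"]) blast+
  then show False
    using \<eta>(2)[OF L0] by simp
qed

lemma energy_nonneg: "0 \<le> energy \<Omega> z z' t"
  by (simp add: energy_def)

text \<open>The source on the first interval is zero, so the energy remains zero up to and including the next
  sampling time. If that were finite, the velocity would have to jump by \<open>\<eta> > 0\<close> there.\<close>

lemma event_triggered_solution_zero:
  assumes dom: "open \<Omega>" "bounded \<Omega>"
    and sol: "event_triggered_solution \<Omega> \<alpha> \<gamma>\<^sub>0 \<gamma>\<^sub>1 \<eta> z\<^sub>0 z\<^sub>1 z z' \<tau>"
    and \<gamma>: "0 \<le> \<gamma>\<^sub>0" "0 \<le> \<gamma>\<^sub>1"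
    and \<eta>: "continuous_on {0..} \<eta>" "\<And>t. 0 \<le> t \<Longrightarrow> 0 < \<eta> t"
    and E0: "energy \<Omega> z z' 0 = 0" and t: "0 \<le> t"
  shows "energy \<Omega> z z' t = 0"
proof -
  have fin: "finite_energy_curve \<Omega> z z'" and ev: "event_times \<Omega> \<gamma>\<^sub>0 \<gamma>\<^sub>1 \<eta> z z' \<tau>"
    and wave: "weak_wave_solution_on \<Omega> {s. \<tau> k \<le> ereal s \<and> ereal s < \<tau> (Suc k)}
            (\<lambda>x. - \<alpha> * z' (real_of_ereal (\<tau> k)) x) z z'" for k
    using sol by (auto simp: event_triggered_solution_def)
  note F = finite_energy_curveD[OF fin]
  have \<tau>0: "\<tau> 0 = 0"
    using ev by (simp add: event_times_def)
  have v0: "L2_norm \<Omega> (z' r) = 0" if "energy \<Omega> z z' r = 0" for r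
    using that by (simp add: energy_def add_nonneg_eq_0_iff)
  have zero: "energy \<Omega> z z' r = 0" if r: "0 \<le> r" "ereal r \<le> \<tau> (Suc 0)" for r
  proof -
    have f: "(\<lambda>x. - \<alpha> * z' 0 x) \<in> L2_space \<Omega>"
      using F(4)[of 0] by (intro L2_space_cmult) auto
    have "L2_inner \<Omega> (\<lambda>x. - \<alpha> * z' 0 x) h = 0" if "h \<in> L2_space \<Omega>" for h
      using L2_inner_Cauchy_Schwarz[OF F(4)[of 0] that] v0[OF E0]
      by (simp only: L2_inner_cmult_left) simp
    moreover have "energy \<Omega> z z' r - energy \<Omega> z z' 0
        = L2_inner \<Omega> (\<lambda>x. - \<alpha> * z' 0 x) (z r) - L2_inner \<Omega> (\<lambda>x. - \<alpha> * z' 0 x) (z 0)"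
    proof (rule energy_identity_closed[OF dom fin f, where X = r])
      show "weak_wave_solution_on \<Omega> {s. \<tau> 0 \<le> ereal s \<and> ereal s < \<tau> (Suc 0)} (\<lambda>x. - \<alpha> * z' 0 x) z z'"
        using wave[of 0] by (simp add: \<tau>0)
      show "{0..<r} \<subseteq> {s. \<tau> 0 \<le> ereal s \<and> ereal s < \<tau> (Suc 0)}"
        using less_le_trans[OF _ r(2), of "ereal s" for s] by (auto simp: \<tau>0)
    qed (use r in auto)
    ultimately show ?thesis
      using E0 F(3) r by simp
  qed
  have "\<tau> (Suc 0) = \<infinity>"
  proof (rule ccontr)
    assume "\<tau> (Suc 0) \<noteq> \<infinity>"
    moreover have nn: "0 \<le> \<tau> (Suc 0)"
      using monoD[OF event_times_mono[OF ev], of 0 "Suc 0"] \<tau>0 by simp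
    ultimately obtain b where b: "\<tau> (Suc 0) = ereal b" "0 \<le> b"
      by (cases "\<tau> (Suc 0)") auto
    have "\<eta> b \<le> (L2_norm \<Omega> (\<lambda>x. z' b x - z' 0 x))\<^sup>2"
      using \<tau>0 by (intro velocity_jump_at_next_sampling[OF ev fin \<gamma> \<eta>(1) _ b(1)]) (auto simp: zero_ereal_def)
    moreover have "L2_norm \<Omega> (\<lambda>x. z' b x - z' 0 x) = 0"
    proof (rule antisym)
      have "(L2_norm \<Omega> (\<lambda>x. z' b x + (- 1) *\<^sub>R z' 0 x))\<^sup>2 = 2 * (- 1) * L2_inner \<Omega> (z' b) (z' 0)"
        using L2_norm_add_scaleR_power2[of "z' b" \<Omega> "z' 0" "- 1"] F(4) b v0[OF zero] v0[OF E0] by simp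
      moreover have "L2_inner \<Omega> (z' b) (z' 0) = 0"
        using L2_inner_Cauchy_Schwarz[OF F(4)[of b] F(4)[of 0]] b v0[OF E0] by simp
      ultimately show "L2_norm \<Omega> (\<lambda>x. z' b x - z' 0 x) \<le> 0" by simp
    qed simp
    ultimately show False
      using \<eta>(2)[OF b(2)] by simp
  qed
  then show ?thesis
    using zero t by simp
qed

section \<open>Exponential stability\<close>

text \<open>An admissible constant below \<open>\<surd>2\<close> exists by the definition of the infimum; squaring gives the factor \<open>2\<close>.\<close>

lemma poincare_inequality:
  assumes "poincare_constant \<Omega> < ereal (sqrt 2)" "u \<in> H10_space \<Omega>"
  shows "(L2_norm \<Omega> u)\<^sup>2 \<le> 2 * (L2_norm \<Omega> (weak_gradient \<Omega> u))\<^sup>2"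
proof -
  obtain C where C: "0 \<le> C" "C < sqrt 2" "L2_norm \<Omega> u \<le> C * L2_norm \<Omega> (weak_gradient \<Omega> u)"
    using assms unfolding poincare_constant_def INF_less_iff by auto
  have "L2_norm \<Omega> u \<le> sqrt 2 * L2_norm \<Omega> (weak_gradient \<Omega> u)"
    using C mult_right_mono[of C "sqrt 2" "L2_norm \<Omega> (weak_gradient \<Omega> u)"] by simp
  then have "(L2_norm \<Omega> u)\<^sup>2 \<le> (sqrt 2 * L2_norm \<Omega> (weak_gradient \<Omega> u))\<^sup>2"
    by (intro power_mono) auto
  then show ?thesis
    by (simp add: power_mult_distrib)
qed

text \<open>Induction over the sampling intervals, which cover the half line. The functional is defined by the
  state alone, so no loss occurs when the source changes.\<close>

lemma weighted_lyapunov_le_initial: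
  assumes dom: "open \<Omega>" "bounded \<Omega>"
    and sol: "event_triggered_solution \<Omega> \<alpha> (\<epsilon> / (8 * \<alpha>)) (1 / 8) (\<lambda>t. exp (- t)) z\<^sub>0 z\<^sub>1 z z' \<tau>"
    and P: "\<And>u. u \<in> H10_space \<Omega> \<Longrightarrow> (L2_norm \<Omega> u)\<^sup>2 \<le> 2 * (L2_norm \<Omega> (weak_gradient \<Omega> u))\<^sup>2"
    and \<alpha>: "0 < \<alpha>" and \<epsilon>: "0 < \<epsilon>" "\<epsilon> \<le> \<alpha> / 8" "\<epsilon> * \<alpha> \<le> 1 / 4" "\<epsilon> \<le> 1 / 4" and t: "0 \<le> t"
  defines "W \<equiv> \<lambda>t. exp (\<epsilon> / 2 * t) * lyapunov \<Omega> \<alpha> \<epsilon> z z' t + \<alpha> / (1 - \<epsilon> / 2) * exp (- (1 - \<epsilon> / 2) * t)"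
  shows "W t \<le> W 0"
proof -
  have fin: "finite_energy_curve \<Omega> z z'" and ev: "event_times \<Omega> (\<epsilon> / (8 * \<alpha>)) (1 / 8) (\<lambda>t. exp (- t)) z z' \<tau>"
    and wave: "weak_wave_solution_on \<Omega> {s. \<tau> k \<le> ereal s \<and> ereal s < \<tau> (Suc k)}
            (\<lambda>x. - \<alpha> * z' (real_of_ereal (\<tau> k)) x) z z'" for k
    using sol by (auto simp: event_triggered_solution_def)
  have \<tau>0: "\<tau> 0 = 0"
    using ev by (simp add: event_times_def)
  have upto: "W r \<le> W 0" if "0 \<le> r" "ereal r \<le> \<tau> k" for k r
    using that
  proof (induction k arbitrary: r)
    case 0
    then show ?case by (simp add: \<tau>0 zero_ereal_def)
  next
    case (Suc k)
    show ?case
    proof (cases "ereal r \<le> \<tau> k")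
      case True
      then show ?thesis using Suc by simp
    next
      case False
      have "0 \<le> \<tau> k"
        using monoD[OF event_times_mono[OF ev], of 0 k] \<tau>0 by simp
      with False obtain a where a: "\<tau> k = ereal a" "0 \<le> a" "a \<le> r"
        by (cases "\<tau> k") auto
      have lt: "ereal s < \<tau> (Suc k)" if "s < r" for s
        by (rule less_le_trans[OF _ Suc.prems(2)]) (simp add: that)
      have "W r \<le> W a"
        unfolding W_def
      proof (rule weighted_lyapunov_decreases_between_samples[OF dom fin a(2,3) _ _ _ \<alpha> \<epsilon>])
        show "weak_wave_solution_on \<Omega> {s. \<tau> k \<le> ereal s \<and> ereal s < \<tau> (Suc k)} (\<lambda>x. - \<alpha> * z' a x) z z'"
          using wave[of k] by (simp add: a)
        show "{a..<r} \<subseteq> {s. \<tau> k \<le> ereal s \<and> ereal s < \<tau> (Suc k)}"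
          using lt by (auto simp: a)
        show "(L2_norm \<Omega> (z s))\<^sup>2 \<le> 2 * (L2_norm \<Omega> (weak_gradient \<Omega> (z s)))\<^sup>2" if "0 \<le> s" for s
          using P finite_energy_curveD(1)[OF fin that] .
        show "(L2_norm \<Omega> (\<lambda>x. z' s x - z' a x))\<^sup>2
            \<le> \<epsilon> / (8 * \<alpha>) * (L2_norm \<Omega> (z s))\<^sup>2 + 1 / 8 * (L2_norm \<Omega> (z' s))\<^sup>2 + exp (- s)"
          if "a \<le> s" "s < r" for s
          using no_event_before_next_sampling[OF ev a(1) that(1) lt[OF that(2)]] .
      qed
      also have "W a \<le> W 0"
        using Suc.IH[of a] a by simp
      finally show ?thesis .
    qed
  qed
  have "\<exists>k. ereal t < \<tau> k"
    using \<alpha> \<epsilon> by (intro sampling_times_unbounded[OF ev fin]) (auto intro!: continuous_intros)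
  then show ?thesis
    using upto t less_imp_le by blast
qed

theorem theorem2:
  fixes \<Omega> :: "'a::euclidean_space set" and \<alpha> :: real
  assumes "\<alpha> > 0"
    and "open \<Omega>" and "connected \<Omega>" and "\<Omega> \<noteq> {}" and "bounded \<Omega>"
    and "poincare_constant \<Omega> < ereal (sqrt 2)"
  shows "\<exists>\<gamma>\<^sub>0>0. \<exists>\<gamma>\<^sub>1>0. \<exists>\<eta>\<^sub>0\<in>C0_halfline.
           strict_antimono_on {0..} \<eta>\<^sub>0 \<and> (\<forall>t\<ge>0. \<eta>\<^sub>0 t > 0) \<and>
           (\<forall>z\<^sub>0\<in>H10_space \<Omega>. \<forall>z\<^sub>1\<in>L2_space \<Omega>. \<forall>z z' \<tau>.
              event_triggered_solution \<Omega> \<alpha> \<gamma>\<^sub>0 \<gamma>\<^sub>1 \<eta>\<^sub>0 z\<^sub>0 z\<^sub>1 z z' \<tau> \<longrightarrow>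
              (\<exists>K>0. \<exists>\<delta>>0. \<forall>t>0.
                 energy \<Omega> z z' t \<le> K * exp (- \<delta> * t) * energy \<Omega> z z' 0))"
proof -
  note dom = \<open>open \<Omega>\<close> \<open>bounded \<Omega>\<close>
  \<comment> \<open>the three bounds are those of \<open>damping_dominates\<close> and of the equivalence with the energy\<close>
  define \<epsilon> where "\<epsilon> = min (\<alpha> / 8) (min (1 / (4 * \<alpha>)) (1 / 4))"
  have "\<epsilon> \<le> 1 / (4 * \<alpha>)" by (simp add: \<epsilon>_def)
  then have "\<epsilon> * \<alpha> \<le> 1 / 4"
    using \<open>\<alpha> > 0\<close> by (simp add: field_simps)
  then have \<epsilon>: "0 < \<epsilon>" "\<epsilon> \<le> \<alpha> / 8" "\<epsilon> * \<alpha> \<le> 1 / 4" "\<epsilon> \<le> 1 / 4"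
    using \<open>\<alpha> > 0\<close> by (auto simp: \<epsilon>_def)
  note P = poincare_inequality[OF assms(6)]
  define \<eta> where "\<eta> = (\<lambda>t::real. exp (- t))"
  have decay: "\<exists>K>0. \<exists>\<delta>>0. \<forall>t>0. energy \<Omega> z z' t \<le> K * exp (- \<delta> * t) * energy \<Omega> z z' 0"
    if sol: "event_triggered_solution \<Omega> \<alpha> (\<epsilon> / (8 * \<alpha>)) (1 / 8) \<eta> z\<^sub>0 z\<^sub>1 z z' \<tau>" for z\<^sub>0 z\<^sub>1 z z' \<tau>
  proof (cases "energy \<Omega> z z' 0 = 0")
    case True
    have "energy \<Omega> z z' t = 0" if "0 < t" for t
      using \<epsilon> \<open>\<alpha> > 0\<close> that
      by (intro event_triggered_solution_zero[OF dom sol _ _ _ _ True]) (auto simp: \<eta>_def intro!: continuous_intros)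
    then show ?thesis
      using True by (intro exI[of _ 1] conjI) auto
  next
    case False
    define E0 where "E0 = energy \<Omega> z z' 0"
    have E0: "0 < E0"
      using False energy_nonneg[of \<Omega> z z' 0] by (simp add: E0_def)
    define c where "c = \<alpha> / (1 - \<epsilon> / 2)"
    have c: "0 < c"
      using \<open>\<alpha> > 0\<close> \<epsilon> by (simp add: c_def)
    have fin: "finite_energy_curve \<Omega> z z'"
      using sol by (simp add: event_triggered_solution_def)
    have zH: "z t \<in> H10_space \<Omega>" if "0 \<le> t" for t
      using finite_energy_curveD(1)[OF fin that] .
    have "energy \<Omega> z z' t \<le> (2 * (2 * E0 + c) / E0) * exp (- (\<epsilon> / 2) * t) * E0" if t: "0 < t" for t
    proof -
      have "exp (\<epsilon> / 2 * t) * lyapunov \<Omega> \<alpha> \<epsilon> z z' t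
          \<le> exp (\<epsilon> / 2 * t) * lyapunov \<Omega> \<alpha> \<epsilon> z z' t + c * exp (- (1 - \<epsilon> / 2) * t)"
        using c by simp
      also have "\<dots> \<le> exp (\<epsilon> / 2 * 0) * lyapunov \<Omega> \<alpha> \<epsilon> z z' 0 + c * exp (- (1 - \<epsilon> / 2) * 0)"
        unfolding c_def
        by (rule weighted_lyapunov_le_initial[OF dom sol[unfolded \<eta>_def] P \<open>\<alpha> > 0\<close> \<epsilon>]) (use t in auto)
      also have "\<dots> \<le> 2 * E0 + c"
        using lyapunov_energy_bounds(2)[OF fin order_refl P[OF zH] \<epsilon>(1,4,3) \<open>\<alpha> > 0\<close>] by (simp add: E0_def)
      finally have "exp (- (\<epsilon> / 2) * t) * (exp (\<epsilon> / 2 * t) * lyapunov \<Omega> \<alpha> \<epsilon> z z' t) \<le> exp (- (\<epsilon> / 2) * t) * (2 * E0 + c)"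
        by (intro mult_left_mono) auto
      then have "lyapunov \<Omega> \<alpha> \<epsilon> z z' t \<le> exp (- (\<epsilon> / 2) * t) * (2 * E0 + c)"
        by (simp add: mult.assoc[symmetric] exp_add[symmetric])
      moreover have "energy \<Omega> z z' t \<le> 2 * lyapunov \<Omega> \<alpha> \<epsilon> z z' t"
        using t by (intro lyapunov_energy_bounds(1)[OF fin _ P[OF zH] \<epsilon>(1,4,3) \<open>\<alpha> > 0\<close>]) auto
      ultimately have "energy \<Omega> z z' t \<le> 2 * (exp (- (\<epsilon> / 2) * t) * (2 * E0 + c))"
        by linarith
      also have "\<dots> = (2 * (2 * E0 + c) / E0) * exp (- (\<epsilon> / 2) * t) * E0"
        using E0 by simp
      finally show ?thesis .
    qed
    moreover have "0 < 2 * (2 * E0 + c) / E0"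
      using E0 c by simp
    ultimately show ?thesis
      using \<epsilon> unfolding E0_def by (metis half_gt_zero)
  qed
  have "\<eta> \<in> C0_halfline"
    by (auto simp: C0_halfline_def \<eta>_def intro!: continuous_intros filterlim_compose[OF exp_at_bot filterlim_uminus_at_bot_at_top])
  moreover have "strict_antimono_on {0..} \<eta>"
    by (auto simp: monotone_on_def \<eta>_def)
  moreover have "\<forall>t\<ge>0. \<eta> t > 0"
    by (simp add: \<eta>_def)
  moreover have "0 < \<epsilon> / (8 * \<alpha>)"
    using \<epsilon> \<open>\<alpha> > 0\<close> by simp
  ultimately show ?thesis
    using decay by (intro exI[of _ "\<epsilon> / (8 * \<alpha>)"] exI[of _ "1 / 8"] conjI bexI[of _ \<eta>]) auto
qed

end
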